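(* With the parameters and kernels of the context, fix $\mathbf t>0$ and $\mathbf x\in\mathbb R$. For every $M>0$, $$\mathbf S^\varepsilon_{-\mathbf t,\mathbf x}(\zeta,u)\longrightarrow\mathbf S_{-\mathbf t,\mathbf x}(\zeta,u)\qquad\text{as }\varepsilon\to0,$$ uniformly over $|\zeta-u|\le M$.
   Context: Parameters. Fix $p\in(0,1)$, $q=1-p$, $\rho\in(0,1)$, and integers $a,b\ge0$ with $a+b\ge1$. For $\ell\ge1$ let $\kappa_\ell=0$ if $(\ell-1)\bmod(a+b)\in\{0,\dots,a-1\}$ and $\kappa_\ell=1$ if $(\ell-1)\bmod(a+b)\in\{a,\dots,a+b-1\}$ (sequential and parallel particles respectively, i.e. memory lengths $L_\ell=\kappa_\ell+1\in\{1,2\}$). Set $\lambda=\frac b{a+b}$, $$\theta=\frac{p-q-p(1+\lambda)\rho+\sqrt{(p^2(1-\lambda)^2+4p\lambda)\rho^2-2p(1+\lambda)\rho+1}}{2q(1-\lambda\rho)}\in(0,p/q),$$ $$\alpha=\frac{(p-q\theta)^2}{pq(1+\theta)^2+\lambda(p-q\theta)^2},\qquad\beta=\frac{p(q(1+\theta)^2-1)}{pq(1+\theta)^2+\lambda(p-q\theta)^2},$$ $$\gamma=\Big(\frac{pq\theta}{2(p-q\theta)^2}+\frac{\theta\lambda}{2(1+\theta)^2}\Big)^{1/2},\qquad\sigma=\Big(\frac{2pq\theta(1+\theta)(p-q\theta)}{\gamma(pq(1+\theta)^2+\lambda(p-q\theta)^2)^2}\Big)^{1/3}.$$ Unscaled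 kernel. For integers $t\geq 0$, $n\ge1$ and $y,x\in\mathbb Z$, $$\mathcal S_{-n}(y,x)=\frac1{2\pi\mathrm i}\oint_{\gamma_r}dw\,\frac{\theta^{x-y}}{w^{x-y+n+1}}(1+w)^t\prod_{\ell=1}^{n}\frac{p/q-w}{(1+w)^{\kappa_\ell}}\,\frac{(1+\theta)^{\kappa_\ell}\,\theta}{p/q-\theta},$$ where $\gamma_r$ is the positively oriented circle around $0$ of radius $r\in(0,1)$. Scaling. Given $\mathbf t,\mathbf x,\zeta,u$ and $\varepsilon>0$, let $t=\varepsilon^{-3/2}\mathbf t$, $n=\alpha\varepsilon^{-3/2}\mathbf t-\sigma^2\varepsilon^{-1}\mathbf x$, $x=\beta\varepsilon^{-3/2}\mathbf t+\rho^{-1}\sigma^2\varepsilon^{-1}\mathbf x+\gamma\sigma\varepsilon^{-1/2}u$, $y=\gamma\sigma\varepsilon^{-1/2}\zeta$ (each replaced by its integer part), and $$\mathbf S^\varepsilon_{-\mathbf t,\mathbf x}(\zeta,u)=\gamma\sigma\varepsilon^{-1/2}(1+\theta)^{-t}\mathcal S_{-n}(y,x).$$ Limit kernel. For $\mathbf t>0$ and $\mathbf x\in\mathbb R$, $\mathbf S_{\mathbf t,\mathbf x}(u,v)=\mathbf t^{-1/3}e^{\frac{2\mathbf x^3}{3\mathbf t^2}-\frac{(u-v)\mathbf x}{\mathbf t}}\mathrm{Ai}\big(\mathbf t^{-1/3}(v-u)+\mathbf t^{-4/3}\mathbf x^2\big)$, with $\mathrm{Ai}$ the Airy function, and $\mathbf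 S_{-\mathbf t,\mathbf x}(\zeta,u)=\mathbf S_{\mathbf t,\mathbf x}(u,\zeta)$. *)

theory Defs
  imports "HOL-Complex_Analysis.Complex_Analysis"
begin

text \<open>
  Throughout, \<open>p\<close> and \<open>\<rho>\<close> lie in \<open>(0,1)\<close>, \<open>q = 1 - p\<close>, and \<open>a + b \<ge> 1\<close>; in each period of
  \<open>a + b\<close> particles the first \<open>a\<close> are sequential and the last \<open>b\<close> are parallel.
\<close>

definition kappa :: "nat \<Rightarrow> nat \<Rightarrow> nat \<Rightarrow> nat" where
  "kappa a b l = (if (l - 1) mod (a + b) < a then 0 else 1)"

definition lam :: "nat \<Rightarrow> nat \<Rightarrow> real" where
  "lam a b = real b / real (a + b)"

definition theta :: "real \<Rightarrow> real \<Rightarrow> nat \<Rightarrow> nat \<Rightarrow> real" where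
  "theta p \<rho> a b = (let q = 1 - p; \<Lambda> = lam a b in
     (p - q - p * (1 + \<Lambda>) * \<rho>
        + sqrt ((p\<^sup>2 * (1 - \<Lambda>)\<^sup>2 + 4 * p * \<Lambda>) * \<rho>\<^sup>2 - 2 * p * (1 + \<Lambda>) * \<rho> + 1))
     / (2 * q * (1 - \<Lambda> * \<rho>)))"

definition alpha :: "real \<Rightarrow> real \<Rightarrow> nat \<Rightarrow> nat \<Rightarrow> real" where
  "alpha p \<rho> a b = (let q = 1 - p; \<Lambda> = lam a b; \<theta> = theta p \<rho> a b in
     (p - q * \<theta>)\<^sup>2 / (p * q * (1 + \<theta>)\<^sup>2 + \<Lambda> * (p - q * \<theta>)\<^sup>2))"

definition beta :: "real \<Rightarrow> real \<Rightarrow> nat \<Rightarrow> nat \<Rightarrow> real" where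
  "beta p \<rho> a b = (let q = 1 - p; \<Lambda> = lam a b; \<theta> = theta p \<rho> a b in
     p * (q * (1 + \<theta>)\<^sup>2 - 1) / (p * q * (1 + \<theta>)\<^sup>2 + \<Lambda> * (p - q * \<theta>)\<^sup>2))"

definition gam :: "real \<Rightarrow> real \<Rightarrow> nat \<Rightarrow> nat \<Rightarrow> real" where
  "gam p \<rho> a b = (let q = 1 - p; \<Lambda> = lam a b; \<theta> = theta p \<rho> a b in
     sqrt (p * q * \<theta> / (2 * (p - q * \<theta>)\<^sup>2) + \<theta> * \<Lambda> / (2 * (1 + \<theta>)\<^sup>2)))"

definition sigma :: "real \<Rightarrow> real \<Rightarrow> nat \<Rightarrow> nat \<Rightarrow> real" where
  "sigma p \<rho> a b = (let q = 1 - p; \<Lambda> = lam a b; \<theta> = theta p \<rho> a b; \<gamma> = gam p \<rho> a b in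
     root 3 (2 * p * q * \<theta> * (1 + \<theta>) * (p - q * \<theta>)
       / (\<gamma> * (p * q * (1 + \<theta>)\<^sup>2 + \<Lambda> * (p - q * \<theta>)\<^sup>2)\<^sup>2)))"

text \<open>
  The kernel \<open>S_{-n}(y,x)\<close> at time \<open>t\<close>, with the contour radius \<open>r\<close> kept as a parameter
  (the value is the same for all \<open>r\<close> in \<open>(0,1)\<close>).
\<close>

definition kernel_S ::
  "real \<Rightarrow> real \<Rightarrow> nat \<Rightarrow> nat \<Rightarrow> real \<Rightarrow> nat \<Rightarrow> nat \<Rightarrow> int \<Rightarrow> int \<Rightarrow> complex" where
  "kernel_S p \<rho> a b r t n y x = (let q = 1 - p; \<theta> = theta p \<rho> a b in
     1 / (2 * of_real pi * \<i>) *
     contour_integral (circlepath 0 r)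
       (\<lambda>w. of_real (\<theta> powi (x - y)) / w powi (x - y + int n + 1) * (1 + w) ^ t *
            (\<Prod>l=1..n. (of_real (p / q) - w) / (1 + w) ^ kappa a b l
                       * of_real ((1 + \<theta>) ^ kappa a b l * \<theta> / (p / q - \<theta>)))))"

text \<open>
  The rescaled kernel at macroscopic time \<open>T\<close> and position \<open>X\<close>. Integer parts are floors;
  the truncation of \<open>t\<close> and \<open>n\<close> to natural numbers is vacuous for \<open>T > 0\<close> and small \<open>\<epsilon> > 0\<close>.
\<close>

definition kernel_S_eps ::
  "real \<Rightarrow> real \<Rightarrow> nat \<Rightarrow> nat \<Rightarrow> real \<Rightarrow> real \<Rightarrow> real \<Rightarrow> real \<Rightarrow> real \<Rightarrow> real \<Rightarrow> complex" where
  "kernel_S_eps p \<rho> a b r T X \<epsilon> \<zeta> u =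
     (let \<theta> = theta p \<rho> a b; \<alpha> = alpha p \<rho> a b; \<beta> = beta p \<rho> a b;
          \<gamma> = gam p \<rho> a b; \<sigma> = sigma p \<rho> a b;
          t = nat \<lfloor>\<epsilon> powr (-3/2) * T\<rfloor>;
          n = nat \<lfloor>\<alpha> * \<epsilon> powr (-3/2) * T - \<sigma>\<^sup>2 * \<epsilon> powr (-1) * X\<rfloor>;
          x = \<lfloor>\<beta> * \<epsilon> powr (-3/2) * T + \<sigma>\<^sup>2 / \<rho> * \<epsilon> powr (-1) * X + \<gamma> * \<sigma> * \<epsilon> powr (-1/2) * u\<rfloor>;
          y = \<lfloor>\<gamma> * \<sigma> * \<epsilon> powr (-1/2) * \<zeta>\<rfloor>
      in of_real (\<gamma> * \<sigma> * \<epsilon> powr (-1/2) / (1 + \<theta>) ^ t) * kernel_S p \<rho> a b r t n y x)"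

text \<open>
  The Airy function, \<open>Ai(z) = 1/(2 \<pi> i) \<integral> exp (w\<^sup>3/3 - z w) dw\<close> along the two rays from
  \<open>exp(-i\<pi>/3) \<infinity>\<close> through \<open>0\<close> to \<open>exp(i\<pi>/3) \<infinity>\<close>.
\<close>

definition Airy :: "complex \<Rightarrow> complex" where
  "Airy z = Lim at_top (\<lambda>R::real. 1 / (2 * of_real pi * \<i>) *
     contour_integral (linepath (of_real R * cis (- pi / 3)) 0 +++ linepath 0 (of_real R * cis (pi / 3)))
       (\<lambda>w. exp (w ^ 3 / 3 - z * w)))"

definition limit_S :: "real \<Rightarrow> real \<Rightarrow> real \<Rightarrow> real \<Rightarrow> complex" where
  "limit_S T X u v =
     of_real (T powr (-1/3) * exp (2 * X ^ 3 / (3 * T\<^sup>2) - (u - v) * X / T))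
     * Airy (of_real (T powr (-1/3) * (v - u) + T powr (-4/3) * X\<^sup>2))"

definition limit_S_minus :: "real \<Rightarrow> real \<Rightarrow> real \<Rightarrow> real \<Rightarrow> complex" where
  "limit_S_minus T X \<zeta> u = limit_S T X u \<zeta>"

end

theory Submission
  imports Defs "HOL-Probability.Distributions" "HOL-Real_Asymp.Real_Asymp"
begin

text \<open>
  In the variable \<open>z = log (w / \<theta>)\<close> the integrand of the kernel is, up to a constant, the exponential of
  \<open>k log ((1 + w) / (1 + \<theta>)) + n log ((p/q - w) / (p/q - \<theta>)) - m z\<close>, where \<open>m = x - y + n\<close> and
  \<open>k\<close> is \<open>t\<close> minus the number of parallel particles among the first \<open>n\<close>, so that
  \<open>k\<close>, \<open>n\<close> and \<open>m\<close> are explicit up to bounded rounding errors. The constants are made for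
  two cancellations. The terms of size \<open>\<epsilon> powr (-3/2)\<close> in the exponent have neither a
  linear nor a quadratic part at \<open>z = 0\<close>: the point \<open>w = \<theta>\<close> is a double critical point
  (\<open>critical_slope\<close>, \<open>cubic_expansion\<close>). The terms of size \<open>\<epsilon> powr (-1)\<close> have no linear part,
  because \<open>\<theta>\<close> solves a quadratic equation that encodes the density \<open>\<rho>\<close>
  (\<open>density_slope\<close>, \<open>quadratic_expansion\<close>). Hence in the variable \<open>w\<close> with \<open>z = - \<eta> w\<close>,
  \<open>\<eta> = sqrt \<epsilon> / (\<gamma> \<sigma>)\<close>, the exponent tends to \<open>T w^3/3 + X w^2 + (u - \<zeta>) w\<close>
  (\<open>profile_tendsto\<close>), and the values of \<open>\<gamma>\<close> and \<open>\<sigma>\<close> are those that produce these coefficients.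

  The contour is not a curve of steepest descent but simply the circle of radius
  \<open>\<theta> exp (- \<eta> c)\<close>, which is (a piece of) the vertical line \<open>Re w = c\<close> in the scaled variable. On a
  circle about the origin \<open>|1 + w|^2\<close> and \<open>|p/q - w|^2\<close> are affine functions of the cosine of the
  angle, and \<open>1 + v \<le> exp v\<close> turns this into a bound by a Gaussian that holds on the entire
  circle, not only near \<open>\<theta>\<close> (\<open>profile_gaussian_bound\<close>). Its variance stays bounded if \<open>T c + X > 0\<close>. Thus no separate estimate away from the critical point is needed, and
  dominated convergence applies. The points \<open>\<zeta>\<close> and \<open>u\<close> enter only through the factor
  \<open>exp ((u - \<zeta>) w)\<close>, of modulus at most \<open>exp (M c)\<close>, and through one more bounded rounding
  error; this gives the uniformity (\<open>uniform_limit_tilted_integrals\<close>). Finally the integral over the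
  vertical line is the Airy function, after a deformation of the two rays
  in its definition and a linear change of the variable (\<open>limit_S_minus_vertical_line\<close>).
\<close>

section \<open>Parameters and the double critical point\<close>

locale tasep_parameters =
  fixes p \<rho> :: real and a b :: nat
  assumes p: "0 < p" "p < 1" and \<rho>: "0 < \<rho>" "\<rho> < 1" and ab: "a + b \<ge> 1"
begin

abbreviation q :: real where "q \<equiv> 1 - p"
abbreviation \<Lambda> :: real where "\<Lambda> \<equiv> lam a b"
abbreviation \<theta> :: real where "\<theta> \<equiv> theta p \<rho> a b"
abbreviation \<alpha> :: real where "\<alpha> \<equiv> alpha p \<rho> a b"
abbreviation \<beta> :: real where "\<beta> \<equiv> beta p \<rho> a b"
abbreviation \<gamma> :: real where "\<gamma> \<equiv> gam p \<rho> a b"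
abbreviation \<sigma> :: real where "\<sigma> \<equiv> sigma p \<rho> a b"
definition odds :: real where "odds = p / q"

lemma q: "0 < q" "q < 1"
  using p by auto

lemma lam_bounds: "0 \<le> \<Lambda>" "\<Lambda> \<le> 1"
  by (auto simp: lam_def divide_simps)

lemma one_minus_lam_rho: "0 < 1 - \<Lambda> * \<rho>"
proof -
  have "\<Lambda> * \<rho> \<le> 1 * \<rho>"
    using lam_bounds \<rho> by (intro mult_right_mono) auto
  thus ?thesis using \<rho> by linarith
qed

text \<open>
  The explicit value of \<open>\<theta>\<close> is the larger root of this quadratic polynomial. Its constant term is negative,
  so the roots have opposite signs.
\<close>
lemma theta_quadratic:
  "q * (1 - \<Lambda> * \<rho>) * \<theta>\<^sup>2 - (p - q - p * (1 + \<Lambda>) * \<rho>) * \<theta> - p * (1 - \<rho>) = 0"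
  and theta_pos: "0 < \<theta>"
proof -
  define A where "A = q * (1 - \<Lambda> * \<rho>)"
  define B where "B = p - q - p * (1 + \<Lambda>) * \<rho>"
  define C where "C = p * (1 - \<rho>)"
  have A: "A > 0" unfolding A_def using q one_minus_lam_rho by (intro mult_pos_pos) auto
  have C: "C > 0" unfolding C_def using p \<rho> by simp
  have disc: "(p\<^sup>2 * (1 - \<Lambda>)\<^sup>2 + 4 * p * \<Lambda>) * \<rho>\<^sup>2 - 2 * p * (1 + \<Lambda>) * \<rho> + 1 = B\<^sup>2 + 4 * A * C"
    unfolding A_def B_def C_def by algebra
  have th: "\<theta> = (B + sqrt (B\<^sup>2 + 4 * A * C)) / (2 * A)"
    unfolding theta_def Let_def disc unfolding A_def B_def by (simp add: mult.assoc)
  define s where "s = sqrt (B\<^sup>2 + 4 * A * C)"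
  have s2: "s\<^sup>2 = B\<^sup>2 + 4 * A * C" unfolding s_def using A C by simp
  have "\<bar>B\<bar> < s"
    unfolding s_def using A C by (intro real_less_rsqrt) simp
  hence "0 < B + s" by linarith
  thus "0 < \<theta>" unfolding th s_def[symmetric] using A by simp
  have "2 * A * \<theta> = B + s" unfolding th s_def[symmetric] using A by simp
  hence "(2 * A * \<theta> - B)\<^sup>2 = B\<^sup>2 + 4 * A * C" using s2 by simp
  hence "4 * A * (A * \<theta>\<^sup>2 - B * \<theta> - C) = 0" by algebra
  thus "q * (1 - \<Lambda> * \<rho>) * \<theta>\<^sup>2 - (p - q - p * (1 + \<Lambda>) * \<rho>) * \<theta> - p * (1 - \<rho>) = 0"
    using A unfolding mult_eq_0_iff A_def[symmetric] B_def[symmetric] C_def[symmetric] by simp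
qed

text \<open>
  A rearrangement of the quadratic equation. Divided by the two linear factors it expresses the
  density \<open>\<rho>\<close> through \<open>\<theta>\<close>, which is the form that the critical point analysis needs.
\<close>
lemma density_identity: "(p - q * \<theta>) * (1 + \<theta>) = \<rho> * (p * (1 + \<theta>) + \<Lambda> * \<theta> * (p - q * \<theta>))"
  using theta_quadratic by algebra

lemma p_minus_q_theta: "0 < p - q * \<theta>"
proof (rule ccontr)
  assume "\<not> ?thesis"
  hence le: "p - q * \<theta> \<le> 0" by simp
  have "(p - q * \<theta>) * (1 + \<theta> - \<rho> * \<Lambda> * \<theta>) = \<rho> * p * (1 + \<theta>)"
    using density_identity by algebra
  moreover have "\<rho> * p * (1 + \<theta>) > 0" using \<rho> p theta_pos by simp
  moreover have "1 + \<theta> - \<rho> * \<Lambda> * \<theta> > 0"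
  proof -
    have "0 < 1 + \<theta> * (1 - \<Lambda> * \<rho>)"
      using theta_pos one_minus_lam_rho by (simp add: add_pos_pos)
    thus ?thesis by (simp add: algebra_simps)
  qed
  ultimately show False using le by (smt (verit) mult_nonpos_nonneg)
qed

lemma theta_less_odds: "\<theta> < odds"
  using p_minus_q_theta q by (simp add: odds_def field_simps)

lemma inverse_density: "1 / \<rho> = p / (p - q * \<theta>) + \<Lambda> * \<theta> / (1 + \<theta>)"
proof -
  have "1 + \<theta> \<noteq> 0" "p - q * \<theta> \<noteq> 0" using theta_pos p_minus_q_theta by auto
  hence "p / (p - q * \<theta>) + \<Lambda> * \<theta> / (1 + \<theta>) = (p * (1 + \<theta>) + \<Lambda> * \<theta> * (p - q * \<theta>)) / ((p - q * \<theta>) * (1 + \<theta>))"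
    by (subst add_frac_eq) (auto simp: mult.commute)
  also have "\<dots> = 1 / \<rho>"
    using \<rho> \<open>1 + \<theta> \<noteq> 0\<close> \<open>p - q * \<theta> \<noteq> 0\<close> density_identity
    by (subst frac_eq_eq) (simp_all only: mult_eq_0_iff mult.commute, auto)
  finally show ?thesis ..
qed

text \<open>The common denominator of \<open>\<alpha>\<close> and \<open>\<beta>\<close>.\<close>
definition denom :: real where "denom = p * q * (1 + \<theta>)\<^sup>2 + \<Lambda> * (p - q * \<theta>)\<^sup>2"

lemma denom_pos: "0 < denom"
  unfolding denom_def using p q theta_pos lam_bounds
  by (intro add_pos_nonneg mult_pos_pos mult_nonneg_nonneg) auto

lemma alpha_eq: "\<alpha> = (p - q * \<theta>)\<^sup>2 / denom"
  by (simp add: alpha_def Let_def denom_def)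

lemma one_minus_lam_alpha: "1 - \<Lambda> * \<alpha> = p * q * (1 + \<theta>)\<^sup>2 / denom"
  unfolding alpha_eq using denom_pos by (simp add: field_simps) (simp add: denom_def algebra_simps)

lemma alpha_plus_beta: "\<alpha> + \<beta> = q * \<theta>\<^sup>2 / denom"
proof -
  have "\<beta> = p * (q * (1 + \<theta>)\<^sup>2 - 1) / denom" by (simp add: beta_def Let_def denom_def)
  moreover have "(p - q * \<theta>)\<^sup>2 + p * (q * (1 + \<theta>)\<^sup>2 - 1) = q * \<theta>\<^sup>2" by algebra
  ultimately show ?thesis unfolding alpha_eq by (metis add_divide_distrib)
qed

lemma gam_square: "\<gamma>\<^sup>2 = \<theta> * denom / (2 * (p - q * \<theta>)\<^sup>2 * (1 + \<theta>)\<^sup>2)"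
proof -
  have pos: "1 + \<theta> > 0" "p - q * \<theta> > 0" using theta_pos p_minus_q_theta by auto
  have "\<gamma>\<^sup>2 = p * q * \<theta> / (2 * (p - q * \<theta>)\<^sup>2) + \<theta> * \<Lambda> / (2 * (1 + \<theta>)\<^sup>2)"
    unfolding gam_def Let_def using p q theta_pos lam_bounds
    by (intro real_sqrt_pow2 add_nonneg_nonneg divide_nonneg_nonneg mult_nonneg_nonneg) auto
  also have "\<dots> = \<theta> * denom / (2 * (p - q * \<theta>)\<^sup>2 * (1 + \<theta>)\<^sup>2)"
    using pos by (simp add: denom_def divide_simps) algebra
  finally show ?thesis .
qed

lemma gam_pos: "0 < \<gamma>"
proof -
  have "\<gamma>\<^sup>2 > 0" unfolding gam_square using theta_pos p_minus_q_theta denom_pos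
    by (intro divide_pos_pos mult_pos_pos) auto
  moreover have "\<gamma> \<ge> 0" unfolding gam_def Let_def using p q theta_pos lam_bounds
    by (intro real_sqrt_ge_zero add_nonneg_nonneg divide_nonneg_nonneg mult_nonneg_nonneg) auto
  ultimately show ?thesis by (cases "\<gamma> = 0") auto
qed

text \<open>
  The cubic Taylor coefficient of the phase at \<open>\<theta>\<close> is \<open>- 1/3\<close> of this number.
\<close>
definition cubic_coeff :: real where "cubic_coeff = p * q * \<theta>\<^sup>2 / (denom * (1 + \<theta>) * (p - q * \<theta>))"

lemma cubic_coeff_pos: "0 < cubic_coeff"
  unfolding cubic_coeff_def using p q theta_pos denom_pos p_minus_q_theta
  by (intro divide_pos_pos mult_pos_pos) auto

lemma sigma_pos: "0 < \<sigma>"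
proof -
  have "0 < 2 * p * q * \<theta> * (1 + \<theta>) * (p - q * \<theta>) / (\<gamma> * denom\<^sup>2)"
    using p q theta_pos denom_pos p_minus_q_theta gam_pos
    by (intro divide_pos_pos mult_pos_pos) auto
  thus ?thesis unfolding sigma_def Let_def denom_def by (intro real_root_gt_zero) auto
qed

lemma gam_sigma_cubed: "(\<gamma> * \<sigma>) ^ 3 = cubic_coeff"
proof -
  have pos: "1 + \<theta> > 0" "p - q * \<theta> > 0" using theta_pos p_minus_q_theta by auto
  have "\<sigma> ^ 3 = 2 * p * q * \<theta> * (1 + \<theta>) * (p - q * \<theta>) / (\<gamma> * denom\<^sup>2)"
    unfolding sigma_def Let_def denom_def by (simp add: odd_real_root_pow)
  hence "(\<gamma> * \<sigma>) ^ 3 = \<gamma>\<^sup>2 * (2 * p * q * \<theta> * (1 + \<theta>) * (p - q * \<theta>) / denom\<^sup>2)"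
    using gam_pos unfolding power_mult_distrib by (simp add: power2_eq_square power3_eq_cube)
  also have "\<dots> = cubic_coeff"
  proof -
    have "x * denom / (2 * u\<^sup>2 * v\<^sup>2) * (2 * p * q * x * v * u / denom\<^sup>2) = p * q * x\<^sup>2 / (denom * v * u)"
      if "u > 0" "v > 0" for u v x :: real
      using that denom_pos p by (simp add: divide_simps) (simp add: power2_eq_square algebra_simps)
    from this[OF pos(2,1)] show ?thesis unfolding gam_square cubic_coeff_def .
  qed
  finally show ?thesis .
qed

lemma alpha_pos: "0 < \<alpha>"
  unfolding alpha_eq using denom_pos p_minus_q_theta by simp

lemma one_minus_lam_alpha_pos: "0 < 1 - \<Lambda> * \<alpha>"
  unfolding one_minus_lam_alpha using denom_pos p q theta_pos by simp

lemma odds_minus_theta: "odds - \<theta> = (p - q * \<theta>) / q"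
  using q by (simp add: odds_def field_simps)

lemma cubic_coeff_eq: "cubic_coeff = p * \<theta>\<^sup>2 / (denom * (1 + \<theta>) * (odds - \<theta>))"
  unfolding cubic_coeff_def odds_minus_theta using q by simp

lemma inverse_density_minus_1: "1 / \<rho> - 1 = \<Lambda> * \<theta> / (1 + \<theta>) + \<theta> / (odds - \<theta>)"
  unfolding inverse_density odds_minus_theta using p_minus_q_theta q by (simp add: field_simps)

lemma two_gam_square: "2 * \<gamma>\<^sup>2 = \<theta> * (\<Lambda> / (1 + \<theta>)\<^sup>2 + odds / (odds - \<theta>)\<^sup>2)"
proof -
  define u v where "u = p - q * \<theta>" and "v = 1 + \<theta>"
  have uv: "u > 0" "v > 0" using theta_pos p_minus_q_theta by (auto simp: u_def v_def)
  have "odds / (u / q)\<^sup>2 = p * q / u\<^sup>2"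
    using uv q by (simp add: odds_def power_divide power2_eq_square)
  hence "\<Lambda> / v\<^sup>2 + odds / (u / q)\<^sup>2 = denom / (u\<^sup>2 * v\<^sup>2)"
    using uv by (simp add: denom_def u_def[symmetric] v_def[symmetric] add_frac_eq mult.commute add.commute)
  thus ?thesis
    unfolding gam_square odds_minus_theta u_def[symmetric] v_def[symmetric] by simp
qed

lemma nonzero_of_real:
  "of_real (1 + \<theta>) \<noteq> (0::complex)" "of_real (odds - \<theta>) \<noteq> (0::complex)"
  using theta_pos theta_less_odds by (simp_all del: of_real_diff of_real_add)

text \<open>
  The left-hand side is \<open>w\<close> times the derivative of the phase at the leading order. A priori its numerator is a
  general quadratic polynomial in \<open>w\<close>; the values of \<open>\<alpha>\<close> and \<open>\<beta>\<close> make it a multiple of a square,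
  so that \<open>\<theta>\<close> is a double critical point.
\<close>
lemma critical_slope:
  fixes w :: complex
  assumes "1 + w \<noteq> 0" "of_real odds - w \<noteq> 0"
  shows "of_real (1 - \<Lambda> * \<alpha>) * (w / (1 + w)) - of_real \<alpha> * (w / (of_real odds - w)) - of_real (\<alpha> + \<beta>)
    = - of_real p * (w - of_real \<theta>)\<^sup>2 / (of_real denom * (1 + w) * (of_real odds - w))"
proof -
  have *: "p' * q' * (1 + t)\<^sup>2 * w * (odds' - w) - (p' - q' * t)\<^sup>2 * w * (1 + w) - q' * t\<^sup>2 * (1 + w) * (odds' - w)
        = - p' * (w - t)\<^sup>2" if "q' = 1 - p'" "odds' * q' = p'" for p' q' t odds' :: complex
    using that by algebra
  have PP: "of_real odds * of_real q = (of_real p :: complex)"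
    using q by (simp add: odds_def flip: of_real_mult)
  define A B C E where "A = (of_real (p * q * (1 + \<theta>)\<^sup>2) :: complex)" and "B = (of_real ((p - q * \<theta>)\<^sup>2) :: complex)"
    and "C = (of_real (q * \<theta>\<^sup>2) :: complex)" and "E = - of_real p * (w - of_real \<theta>)\<^sup>2"
  have key: "A * w * (of_real odds - w) - B * w * (1 + w) - C * (1 + w) * (of_real odds - w) = E"
    using *[of "of_real q" "of_real p" "of_real odds" "of_real \<theta>"] PP
    unfolding A_def B_def C_def E_def by simp
  have D0: "of_real denom \<noteq> (0 :: complex)" using denom_pos by simp
  have "A / of_real denom * (w / (1 + w)) - B / of_real denom * (w / (of_real odds - w)) - C / of_real denom
      = (A * w * (of_real odds - w) - B * w * (1 + w) - C * (1 + w) * (of_real odds - w)) / (of_real denom * (1 + w) * (of_real odds - w))"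
  proof -
    have "A / d * (w / x) - B / d * (w / y) - C / d = (A * w * y - B * w * x - C * x * y) / (d * x * y)"
      if "x \<noteq> 0" "y \<noteq> 0" "d \<noteq> 0" for x y d
      using that by (simp add: divide_simps mult_ac)
    from this[OF assms D0] show ?thesis .
  qed
  thus ?thesis
    unfolding one_minus_lam_alpha alpha_plus_beta unfolding alpha_eq
    unfolding of_real_divide A_def[symmetric] B_def[symmetric] C_def[symmetric] key E_def .
qed

text \<open>
  The same computation for the part of the phase that multiplies the shift of the particle label. Here
  only a simple zero at \<open>\<theta>\<close> is available, and it is the relation between \<open>\<rho>\<close> and \<open>\<theta>\<close> that provides it.
\<close>
lemma density_slope:
  fixes w :: complex
  assumes "1 + w \<noteq> 0" "of_real odds - w \<noteq> 0"
  shows "of_real \<Lambda> * (w / (1 + w)) + w / (of_real odds - w) - of_real (1 / \<rho> - 1)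
    = (w - of_real \<theta>) * (of_real \<Lambda> / ((1 + w) * of_real (1 + \<theta>)) + of_real odds / ((of_real odds - w) * of_real (odds - \<theta>)))"
proof -
  define t where "t = (of_real \<theta> :: complex)"
  define odds' where "odds' = (of_real odds :: complex)"
  have t: "1 + t \<noteq> 0" "odds' - t \<noteq> 0"
    using nonzero_of_real unfolding t_def odds'_def by simp_all
  have 1: "w / (1 + w) - t / (1 + t) = (w - t) / ((1 + w) * (1 + t))"
    unfolding diff_frac_eq[OF assms(1) t(1)] by (simp add: algebra_simps)
  have 2: "w / (odds' - w) - t / (odds' - t) = (w - t) * odds' / ((odds' - w) * (odds' - t))"
    unfolding diff_frac_eq[OF assms(2)[folded odds'_def] t(2)] by (simp add: algebra_simps)
  have "of_real \<Lambda> * (w / (1 + w)) + w / (odds' - w) - (of_real \<Lambda> * t / (1 + t) + t / (odds' - t))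
      = of_real \<Lambda> * (w / (1 + w) - t / (1 + t)) + (w / (odds' - w) - t / (odds' - t))"
    by (simp add: algebra_simps)
  also have "\<dots> = (w - t) * (of_real \<Lambda> / ((1 + w) * (1 + t)) + odds' / ((odds' - w) * (odds' - t)))"
    unfolding 1 2 by (simp add: algebra_simps)
  finally show ?thesis
    unfolding inverse_density_minus_1 t_def odds'_def by simp
qed

end

section \<open>The Airy function on a vertical line\<close>

lemma integrable_gaussian:
  fixes c :: real
  assumes "c > 0"
  shows "integrable lborel (\<lambda>x. exp (- c * x\<^sup>2))"
proof -
  define s where "s = sqrt (1 / (2 * c))"
  have s: "s > 0" and s2: "s\<^sup>2 = 1 / (2 * c)" using assms by (auto simp: s_def)
  have "integrable lborel (\<lambda>x. sqrt (2 * pi * s\<^sup>2) * normal_density 0 s x)"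
    using s by (intro integrable_mult_right integrable_normal_density)
  also have "(\<lambda>x. sqrt (2 * pi * s\<^sup>2) * normal_density 0 s x) = (\<lambda>x. exp (- c * x\<^sup>2))"
    using assms s by (auto simp: normal_density_def s2 mult.commute)
  finally show ?thesis .
qed

lemma norm_exp_cubic:
  "norm (exp (of_real T * Complex u v ^ 3 / 3 + of_real X * Complex u v ^ 2 - of_real x * Complex u v))
     = exp (T * (u ^ 3 / 3 - u * v\<^sup>2) + X * (u\<^sup>2 - v\<^sup>2) - x * u)"
proof -
  have "Re (of_real T * Complex u v ^ 3 / 3) = T * (u ^ 3 / 3 - u * v\<^sup>2)"
    by (simp add: power3_eq_cube power2_eq_square field_simps)
  moreover have "Re (of_real X * Complex u v ^ 2) = X * (u\<^sup>2 - v\<^sup>2)"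
    by (simp add: power2_eq_square)
  ultimately show ?thesis by (simp only: norm_exp_eq_Re minus_complex.simps plus_complex.simps) simp
qed

lemma tendsto_R_gaussian:
  fixes c x :: real
  assumes "c > 0"
  shows "((\<lambda>R. exp (- 2 * c * R\<^sup>2 / 3 + \<bar>x\<bar> * R) * R) \<longlongrightarrow> 0) at_top"
  using assms by real_asymp

text \<open>
  The integrand is entire, so it has a primitive \<open>F\<close> and every contour integral is a difference of values
  of \<open>F\<close>. This turns the change of contour into a comparison of \<open>F\<close> at the end points of the rays with \<open>F\<close>
  at the points of the vertical line at the same height. On the vertical line the integrand
  is absolutely integrable, unlike on the imaginary axis.
\<close>
lemma Airy_vertical_line:
  fixes x c :: real
  assumes "c > 0"
  shows "Airy (of_real x) =
    1 / (2 * of_real pi) * (\<integral>\<tau>. exp (Complex c \<tau> ^ 3 / 3 - of_real x * Complex c \<tau>) \<partial>lborel)"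
proof -
  define f where "f = (\<lambda>w::complex. exp (w ^ 3 / 3 - of_real x * w))"
  have "f holomorphic_on UNIV" unfolding f_def by (auto intro!: holomorphic_intros)
  then obtain F where F: "\<And>w. (F has_field_derivative f w) (at w)"
    using holomorphic_convex_primitive'[of UNIV f] by auto
  have norm_f: "norm (f (Complex u v)) = exp (u ^ 3 / 3 - u * v\<^sup>2 - x * u)" for u v
    using norm_exp_cubic[of 1 u v 0 x] by (simp add: f_def)
  define A where "A = (\<lambda>s R::real. of_real R * cis (s * pi / 3))"
  define V where "V = (\<lambda>s R::real. Complex c (s * (R * sqrt 3 / 2)))"
  have A_eq: "A s R = Complex (R / 2) (s * (R * sqrt 3 / 2))" if "s = 1 \<or> s = -1" for s R
    using that by (auto simp: A_def complex_eq_iff cos_60 sin_60)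
  \<comment> \<open>The rays end far out at height \<open>R * sqrt 3 / 2\<close>; moving horizontally from there to the
    vertical line costs nothing in the limit.\<close>
  have horiz: "((\<lambda>R. F (A s R) - F (V s R)) \<longlongrightarrow> 0) at_top" if s: "s = 1 \<or> s = -1" for s
  proof (rule Lim_null_comparison)
    show "((\<lambda>R. exp (- 2 * c * R\<^sup>2 / 3 + \<bar>x\<bar> * R) * R) \<longlongrightarrow> 0) at_top"
      by (rule tendsto_R_gaussian[OF assms])
    have "norm (F (A s R) - F (V s R)) \<le> exp (- 2 * c * R\<^sup>2 / 3 + \<bar>x\<bar> * R) * R" if R: "R \<ge> 2 * c" for R
    proof -
      have bound: "norm (f w) \<le> exp (- 2 * c * R\<^sup>2 / 3 + \<bar>x\<bar> * R)"
        if w_in: "w \<in> closed_segment (V s R) (A s R)" for w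
      proof -
        obtain t where t: "0 \<le> t" "t \<le> 1" "w = (1 - t) *\<^sub>R V s R + t *\<^sub>R A s R"
          using w_in by (auto simp: closed_segment_def)
        define u where "u = (1 - t) * c + t * (R / 2)"
        have w: "w = Complex u (s * (R * sqrt 3 / 2))"
          unfolding t A_eq[OF s] V_def u_def by (simp add: complex_eq_iff algebra_simps)
        have "u = c + t * (R / 2 - c)" by (simp add: u_def algebra_simps)
        hence u1: "c \<le> u" using t R by simp
        have "R / 2 - u = (1 - t) * (R / 2 - c)" by (simp add: u_def field_simps)
        moreover have "0 \<le> (1 - t) * (R / 2 - c)" using t R by (intro mult_nonneg_nonneg) auto
        ultimately have u2: "u \<le> R / 2" by linarith
        have v2: "(s * (R * sqrt 3 / 2))\<^sup>2 = 3 / 4 * R\<^sup>2"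
          using s by (auto simp: power_mult_distrib power_divide)
        have "u\<^sup>2 \<le> (R / 2)\<^sup>2" using u1 u2 assms by (intro power_mono) auto
        hence "u * (u\<^sup>2 / 3 - 3 / 4 * R\<^sup>2) \<le> u * (- 2 / 3 * R\<^sup>2)"
          using u1 assms by (intro mult_left_mono) (auto simp: power_divide)
        also have "\<dots> = - (2 / 3 * R\<^sup>2) * u" by simp
        also have "\<dots> \<le> - (2 / 3 * R\<^sup>2) * c" using u1 by (intro mult_left_mono_neg) auto
        finally have "u ^ 3 / 3 - u * (3 / 4 * R\<^sup>2) \<le> - 2 * c * R\<^sup>2 / 3"
          by (simp add: power3_eq_cube power2_eq_square algebra_simps)
        moreover have "- x * u \<le> \<bar>x\<bar> * R"
        proof -
          have "- x * u \<le> \<bar>x\<bar> * u" using u1 assms by (intro mult_right_mono) auto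
          also have "\<dots> \<le> \<bar>x\<bar> * R" using u1 u2 R assms by (intro mult_left_mono) auto
          finally show ?thesis .
        qed
        ultimately show ?thesis unfolding w norm_f v2 by simp
      qed
      have "norm (F (A s R) - F (V s R)) \<le> exp (- 2 * c * R\<^sup>2 / 3 + \<bar>x\<bar> * R) * norm (A s R - V s R)"
        using F bound
        by (intro field_differentiable_bound[where S = "closed_segment (V s R) (A s R)" and f' = f])
           (auto intro: has_field_derivative_at_within)
      also have "norm (A s R - V s R) = \<bar>R / 2 - c\<bar>"
        unfolding A_eq[OF s] V_def by (simp add: cmod_def)
      also have "\<dots> \<le> R" using R assms by auto
      finally show ?thesis by simp
    qed
    thus "\<forall>\<^sub>F R in at_top. norm (F (A s R) - F (V s R)) \<le> exp (- 2 * c * R\<^sup>2 / 3 + \<bar>x\<bar> * R) * R"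
      by (rule eventually_mono[OF eventually_ge_at_top])
  qed
  define I where "I = (\<integral>\<tau>. f (Complex c \<tau>) \<partial>lborel)"
  have cont_line: "continuous_on S (\<lambda>\<tau>. f (Complex c \<tau>))" for S
    unfolding f_def Complex_eq by (auto intro!: continuous_intros)
  have vert: "((\<lambda>R. F (V 1 R) - F (V (-1) R)) \<longlongrightarrow> \<i> * I) at_top"
  proof -
    have FTC: "F (V 1 R) - F (V (-1) R) =
        \<i> * (\<integral>\<tau>. indicator {- (R * sqrt 3 / 2)..R * sqrt 3 / 2} \<tau> *\<^sub>R f (Complex c \<tau>) \<partial>lborel)"
      if "R \<ge> 0" for R
    proof -
      have deriv: "((\<lambda>\<tau>. F (Complex c \<tau>)) has_vector_derivative (\<i> * f (Complex c \<tau>))) (at \<tau> within S)" for \<tau> S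
      proof -
        have "((\<lambda>\<tau>. of_real c + \<i> * of_real \<tau>) has_vector_derivative \<i>) (at \<tau> within S)"
          by (auto intro!: derivative_eq_intros)
        from field_vector_diff_chain_within[OF this, of F "f (Complex c \<tau>)"]
        show ?thesis using F by (simp add: o_def Complex_eq has_field_derivative_at_within)
      qed
      have "has_bochner_integral lborel
          (\<lambda>\<tau>. indicator {- (R * sqrt 3 / 2)..R * sqrt 3 / 2} \<tau> *\<^sub>R (\<i> * f (Complex c \<tau>)))
          (F (Complex c (R * sqrt 3 / 2)) - F (Complex c (- (R * sqrt 3 / 2))))"
        using that deriv cont_line
        by (intro has_bochner_integral_FTC_Icc) (auto intro!: continuous_intros)
      from has_bochner_integral_integral_eq[OF this] show ?thesis
        by (simp add: V_def integral_mult_right_zero[symmetric] del: integral_mult_right_zero)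
    qed
    have "((\<lambda>H. (\<integral>\<tau>. indicator {- H..H} \<tau> *\<^sub>R f (Complex c \<tau>) \<partial>lborel)) \<longlongrightarrow> I) at_top"
      unfolding I_def
    proof (rule integral_dominated_convergence_at_top)
      have meas: "(\<lambda>\<tau>. f (Complex c \<tau>)) \<in> borel_measurable borel"
        by (intro borel_measurable_continuous_onI cont_line)
      show "(\<lambda>\<tau>. f (Complex c \<tau>)) \<in> borel_measurable lborel" using meas by simp
      show "(\<lambda>\<tau>. indicator {- H..H} \<tau> *\<^sub>R f (Complex c \<tau>)) \<in> borel_measurable lborel" for H
        using meas by (intro borel_measurable_scaleR) auto
      show "integrable lborel (\<lambda>\<tau>. exp (c ^ 3 / 3 - x * c) * exp (- c * \<tau>\<^sup>2))"
        by (intro integrable_mult_right integrable_gaussian assms)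
      show "\<forall>\<^sub>F H in at_top. AE \<tau> in lborel. norm (indicator {- H..H} \<tau> *\<^sub>R f (Complex c \<tau>))
              \<le> exp (c ^ 3 / 3 - x * c) * exp (- c * \<tau>\<^sup>2)"
        by (intro always_eventually allI AE_I2)
           (auto simp: norm_f indicator_def exp_add[symmetric] simp flip: exp_add)
      show "AE \<tau> in lborel. ((\<lambda>H. indicator {- H..H} \<tau> *\<^sub>R f (Complex c \<tau>)) \<longlongrightarrow> f (Complex c \<tau>)) at_top"
      proof (intro AE_I2 tendsto_eventually)
        fix \<tau> :: real
        show "\<forall>\<^sub>F H in at_top. indicator {- H..H} \<tau> *\<^sub>R f (Complex c \<tau>) = f (Complex c \<tau>)"
          using eventually_ge_at_top[of "\<bar>\<tau>\<bar>"] by eventually_elim (auto simp: indicator_def)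
      qed
    qed
    moreover have "filterlim (\<lambda>R::real. R * sqrt 3 / 2) at_top at_top" by real_asymp
    ultimately have "((\<lambda>R. (\<integral>\<tau>. indicator {- (R * sqrt 3 / 2)..R * sqrt 3 / 2} \<tau> *\<^sub>R f (Complex c \<tau>) \<partial>lborel)) \<longlongrightarrow> I) at_top"
      by (rule filterlim_compose)
    hence "((\<lambda>R. \<i> * (\<integral>\<tau>. indicator {- (R * sqrt 3 / 2)..R * sqrt 3 / 2} \<tau> *\<^sub>R f (Complex c \<tau>) \<partial>lborel)) \<longlongrightarrow> \<i> * I) at_top"
      by (intro tendsto_intros)
    thus ?thesis
      by (rule Lim_transform_eventually)
         (use eventually_ge_at_top[of 0] in \<open>eventually_elim, simp add: FTC\<close>)
  qed
  have rays: "contour_integral (linepath (of_real R * cis (- pi / 3)) 0 +++ linepath 0 (of_real R * cis (pi / 3))) f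
      = F (A 1 R) - F (A (-1) R)" for R
    using contour_integral_primitive[of UNIV F f
        "linepath (of_real R * cis (- pi / 3)) 0 +++ linepath 0 (of_real R * cis (pi / 3))"] F
    by (auto simp: A_def intro!: contour_integral_unique has_field_derivative_at_within)
  have "((\<lambda>R. (F (A 1 R) - F (V 1 R)) - (F (A (-1) R) - F (V (-1) R)) + (F (V 1 R) - F (V (-1) R)))
      \<longlongrightarrow> 0 - 0 + \<i> * I) at_top"
    by (intro tendsto_add tendsto_diff horiz vert) auto
  hence "((\<lambda>R. F (A 1 R) - F (A (-1) R)) \<longlongrightarrow> \<i> * I) at_top" by simp
  hence "((\<lambda>R. 1 / (2 * of_real pi * \<i>) * (F (A 1 R) - F (A (-1) R))) \<longlongrightarrow>
      1 / (2 * of_real pi * \<i>) * (\<i> * I)) at_top"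
    by (intro tendsto_intros)
  hence "Airy (of_real x) = 1 / (2 * of_real pi * \<i>) * (\<i> * I)"
    unfolding Airy_def f_def[symmetric] rays by (intro tendsto_Lim) auto
  thus ?thesis by (simp add: I_def f_def)
qed

text \<open>
  Completing the cube: the substitution \<open>v = T^(1/3) (w + X/T)\<close> maps \<open>T w^3/3 + X w^2 + (u - \<zeta>) w\<close> to the exponent of
  the Airy function plus the constant that appears as prefactor of the limit kernel. The vertical
  line through \<open>c\<close> is mapped to the right half plane, where the representation of the Airy function is valid,
  because \<open>T c + X > 0\<close>.
\<close>
lemma limit_S_minus_vertical_line:
  fixes T X c \<zeta> u :: real
  assumes "T > 0" "T * c + X > 0"
  shows "limit_S_minus T X \<zeta> u = 1 / (2 * of_real pi) *
    (\<integral>\<tau>. exp (of_real T * Complex c \<tau> ^ 3 / 3 + of_real X * Complex c \<tau> ^ 2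
            + of_real (u - \<zeta>) * Complex c \<tau>) \<partial>lborel)"
proof -
  define k where "k = T powr (1 / 3)"
  have k: "k > 0" using assms by (simp add: k_def)
  have T: "T = k ^ 3"
    using assms by (simp add: k_def powr_power)
  have powrs: "T powr (-1/3) = 1 / k" "T powr (-4/3) = 1 / k ^ 4"
    using assms by (simp_all add: k_def powr_power powr_minus_divide)
  define y where "y = (\<zeta> - u) / k + X\<^sup>2 / k ^ 4"
  define s where "s = 2 * X ^ 3 / (3 * T\<^sup>2) - (u - \<zeta>) * X / T"
  define c' where "c' = k * c + X / k\<^sup>2"
  have c': "c' > 0"
  proof -
    have "c' = (T * c + X) / k\<^sup>2" unfolding c'_def T using k by (simp add: field_simps power2_eq_square power3_eq_cube)
    thus ?thesis using assms k by simp
  qed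
  have "Airy (of_real y) = 1 / (2 * of_real pi) *
      (\<integral>\<tau>. exp (Complex c' \<tau> ^ 3 / 3 - of_real y * Complex c' \<tau>) \<partial>lborel)"
    by (rule Airy_vertical_line[OF c'])
  also have "(\<integral>\<tau>. exp (Complex c' \<tau> ^ 3 / 3 - of_real y * Complex c' \<tau>) \<partial>lborel) =
      k *\<^sub>R (\<integral>\<tau>. exp (Complex c' (k * \<tau>) ^ 3 / 3 - of_real y * Complex c' (k * \<tau>)) \<partial>lborel)"
    using lborel_integral_real_affine[of k "\<lambda>\<tau>. exp (Complex c' \<tau> ^ 3 / 3 - of_real y * Complex c' \<tau>)" 0] k
    by simp
  finally have A: "Airy (of_real y) = 1 / (2 * of_real pi) * (k *\<^sub>R
     (\<integral>\<tau>. exp (Complex c' (k * \<tau>) ^ 3 / 3 - of_real y * Complex c' (k * \<tau>)) \<partial>lborel))" .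
  have expo: "of_real s + (Complex c' (k * \<tau>) ^ 3 / 3 - of_real y * Complex c' (k * \<tau>)) =
     of_real T * Complex c \<tau> ^ 3 / 3 + of_real X * Complex c \<tau> ^ 2 + of_real (u - \<zeta>) * Complex c \<tau>" for \<tau>
  proof -
    define w where "w = Complex c \<tau>"
    \<comment> \<open>All negative powers of \<open>k\<close> that remain are powers of \<open>1 / T\<close>, and \<open>T j = 1\<close> is the only
      relation needed to expand the cube.\<close>
    define j where "j = inverse T"
    have Tj: "of_real T * of_real j = (1 :: complex)"
      using assms by (simp add: j_def of_real_inverse)
    define v where "v = w + of_real (X * j)"
    have 1: "Complex c' (k * \<tau>) = of_real k * v"
      using k unfolding v_def w_def c'_def j_def T
      by (simp add: complex_eq_iff field_simps power2_eq_square power3_eq_cube)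
    have 2: "(of_real k * v) ^ 3 = of_real T * v ^ 3"
      by (simp add: T power_mult_distrib)
    have "y * k = (\<zeta> - u) + X\<^sup>2 * j"
      using k unfolding y_def j_def T by (simp add: field_simps power4_eq_xxxx power3_eq_cube)
    hence 3: "of_real y * (of_real k * v) = (of_real (\<zeta> - u) + of_real X ^ 2 * of_real j) * v"
      by (metis (no_types, lifting) mult.assoc of_real_add of_real_mult of_real_power)
    have 4: "of_real s = 2 * of_real X ^ 3 * of_real j ^ 2 / 3 - of_real (u - \<zeta>) * of_real X * (of_real j :: complex)"
      unfolding s_def j_def by (simp add: field_simps)
    have "of_real T * v ^ 3 = of_real T * w ^ 3 + 3 * (of_real T * of_real j) * of_real X * w ^ 2
        + 3 * (of_real T * of_real j) * of_real j * of_real X ^ 2 * w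
        + (of_real T * of_real j) * of_real j ^ 2 * of_real X ^ 3"
      unfolding v_def of_real_mult by algebra
    hence 5: "of_real T * v ^ 3 = of_real T * w ^ 3 + 3 * of_real X * w ^ 2
        + 3 * of_real j * of_real X ^ 2 * w + of_real j ^ 2 * of_real X ^ 3"
      unfolding Tj by simp
    show ?thesis
      unfolding 1 2 3 4 5 w_def[symmetric] unfolding v_def of_real_mult of_real_diff
      by (simp add: field_simps power2_eq_square power3_eq_cube)
  qed
  have "limit_S_minus T X \<zeta> u = of_real (1 / k * exp s) * Airy (of_real y)"
    unfolding limit_S_minus_def limit_S_def powrs s_def y_def by simp
  also have "\<dots> = 1 / (2 * of_real pi) * (exp (of_real s) *
     (\<integral>\<tau>. exp (Complex c' (k * \<tau>) ^ 3 / 3 - of_real y * Complex c' (k * \<tau>)) \<partial>lborel))"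
    unfolding A using k by (simp add: scaleR_conv_of_real exp_of_real)
  also have "\<dots> = 1 / (2 * of_real pi) *
     (\<integral>\<tau>. exp (of_real s + (Complex c' (k * \<tau>) ^ 3 / 3 - of_real y * Complex c' (k * \<tau>))) \<partial>lborel)"
    by (simp only: exp_add integral_mult_right_zero)
  finally show ?thesis unfolding expo .
qed

section \<open>The kernel as an integral over a circle\<close>

text \<open>
  The standard parametrisation starts at angle \<open>0\<close>. Starting it at angle \<open>- \<pi>\<close> instead makes the range of the scaled
  angle symmetric, so that it exhausts the real line as \<open>h\<close> tends to \<open>0\<close>. The angle is reversed since the
  scaled variable is \<open>w\<close> with \<open>z = - h w\<close>.
\<close>
lemma circle_integral_scaled:
  fixes f :: "complex \<Rightarrow> complex"
  assumes "continuous_on (sphere 0 R) f" "R > 0" "h > 0"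
  shows "1 / (2 * of_real pi * \<i>) * contour_integral (circlepath 0 R) f =
    of_real h / (2 * of_real pi) * (\<integral>\<tau>. indicator {- (pi / h)..pi / h} \<tau> *\<^sub>R
      (f (of_real R * cis (- (h * \<tau>))) * (of_real R * cis (- (h * \<tau>)))) \<partial>lborel)"
proof -
  have "shiftpath (1 / 2) (circlepath 0 R) = circlepath 0 (- R)"
  proof
    fix x :: real
    show "shiftpath (1 / 2) (circlepath 0 R) x = circlepath 0 (- R) x"
      by (simp add: shiftpath_def circlepath_minus circlepath_add_half add.commute)
  qed
  hence "contour_integral (circlepath 0 R) f = contour_integral (circlepath 0 (- R)) f"
    using contour_integral_shiftpath[of "circlepath 0 R" "1 / 2" f] by simp
  also have "\<dots> = integral {0..1} (\<lambda>x. f (circlepath 0 (- R) x) * vector_derivative (circlepath 0 (- R)) (at x))"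
    by (rule contour_integral_integral)
  also have "\<dots> = integral {0..1} (\<lambda>x. 2 * of_real pi * \<i> * (f (circlepath 0 (- R) x) * circlepath 0 (- R) x))"
    unfolding vector_derivative_circlepath by (simp add: circlepath mult_ac)
  also have "\<dots> = 2 * of_real pi * \<i> * integral {0..1} (\<lambda>x. f (circlepath 0 (- R) x) * circlepath 0 (- R) x)"
    by (rule integral_mult_right)
  also have "integral {0..1} (\<lambda>x. f (circlepath 0 (- R) x) * circlepath 0 (- R) x) =
     (\<integral>x. indicator {0..1} x *\<^sub>R (f (circlepath 0 (- R) x) * circlepath 0 (- R) x) \<partial>lborel)"
  proof -
    have "continuous_on {0..1} (circlepath 0 (- R))"
      unfolding circlepath by (intro continuous_intros)
    moreover have "circlepath 0 (- R) ` {0..1} \<subseteq> sphere 0 R"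
      using assms by (auto simp: circlepath norm_mult)
    ultimately have "continuous_on {0..1} (\<lambda>x. f (circlepath 0 (- R) x) * circlepath 0 (- R) x)"
      using assms(1) by (intro continuous_on_mult continuous_on_compose2[OF assms(1)]) auto
    from set_borel_integral_eq_integral(2)[OF borel_integrable_atLeastAtMost'[OF this]]
    show ?thesis by (simp add: set_lebesgue_integral_def)
  qed
  also have "\<dots> = \<bar>- h / (2 * pi)\<bar> *\<^sub>R (\<integral>\<tau>. indicator {0..1} (1 / 2 + (- h / (2 * pi)) * \<tau>) *\<^sub>R
      (f (circlepath 0 (- R) (1 / 2 + (- h / (2 * pi)) * \<tau>)) * circlepath 0 (- R) (1 / 2 + (- h / (2 * pi)) * \<tau>)) \<partial>lborel)"
    using assms by (intro lborel_integral_real_affine) auto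
  also have "(\<lambda>\<tau>. indicator {0..1} (1 / 2 + (- h / (2 * pi)) * \<tau>) :: real) = indicator {- (pi / h)..pi / h}"
    using assms by (auto simp: indicator_def fun_eq_iff field_simps)
  also have "(\<lambda>\<tau>. circlepath 0 (- R) (1 / 2 + (- h / (2 * pi)) * \<tau>)) = (\<lambda>\<tau>. of_real R * cis (- (h * \<tau>)))"
  proof
    fix \<tau> :: real
    have "exp (2 * of_real pi * \<i> * of_real (1 / 2 + (- h / (2 * pi)) * \<tau>)) = exp (of_real pi * \<i> + \<i> * of_real (- (h * \<tau>)))"
      by (intro arg_cong[where f = exp]) (simp add: field_simps)
    also have "\<dots> = - cis (- (h * \<tau>))"
      unfolding exp_add exp_pi_i' by (simp add: cis_conv_exp)
    finally show "circlepath 0 (- R) (1 / 2 + (- h / (2 * pi)) * \<tau>) = of_real R * cis (- (h * \<tau>))"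
      unfolding circlepath by simp
  qed
  finally show ?thesis using assms by (simp add: scaleR_conv_of_real)
qed

text \<open>
  The square of the left-hand side is affine in \<open>cos \<phi>\<close>, and \<open>1 + v \<le> exp v\<close>. Both signs of \<open>x\<close> matter: a negative \<open>x\<close>
  gives the factor \<open>p/q - w\<close> of the integrand.
\<close>
lemma norm_one_plus_circle:
  fixes x \<phi> :: real
  assumes "x \<noteq> -1"
  shows "norm (1 + of_real x * cis \<phi>) \<le> \<bar>1 + x\<bar> * exp (- (x * (1 - cos \<phi>) / (1 + x)\<^sup>2))"
proof (rule power2_le_imp_le)
  define h where "h = 2 * x * (1 - cos \<phi>) / (1 + x)\<^sup>2"
  have "(norm (1 + of_real x * cis \<phi>))\<^sup>2 = (1 + x * cos \<phi>)\<^sup>2 + (x * sin \<phi>)\<^sup>2"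
    by (simp add: cmod_power2)
  also have "\<dots> = (1 + x)\<^sup>2 - 2 * x * (1 - cos \<phi>)"
    using sin_cos_squared_add[of \<phi>] by algebra
  also have "\<dots> = (1 + x)\<^sup>2 * (1 - h)"
    using assms by (simp add: h_def algebra_simps) (simp add: field_simps)
  also have "\<dots> \<le> (1 + x)\<^sup>2 * exp (- h)"
    using exp_ge_add_one_self[of "- h"] by (intro mult_left_mono) auto
  also have "\<dots> = (\<bar>1 + x\<bar> * exp (- (x * (1 - cos \<phi>) / (1 + x)\<^sup>2)))\<^sup>2"
    by (simp add: power_mult_distrib exp_double[symmetric] h_def)
  finally show "(norm (1 + of_real x * cis \<phi>))\<^sup>2 \<le> (\<bar>1 + x\<bar> * exp (- (x * (1 - cos \<phi>) / (1 + x)\<^sup>2)))\<^sup>2" .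
qed auto

text \<open>
  The constant \<open>1/8\<close> is not optimal; it is what the cubic Taylor bound for the sine at half the angle yields.
\<close>
lemma one_minus_cos_lower_bound:
  fixes x :: real
  assumes "\<bar>x\<bar> \<le> pi"
  shows "x\<^sup>2 / 8 \<le> 1 - cos x"
proof -
  have sin_ge: "y / 2 \<le> sin y" if y: "0 \<le> y" "y \<le> pi / 2" for y :: real
  proof -
    have "y\<^sup>2 \<le> (pi / 2)\<^sup>2" using y by (intro power_mono) auto
    also have "\<dots> \<le> (32 / 20)\<^sup>2" using pi_approx by (intro power_mono) auto
    also have "\<dots> \<le> 3" by (simp add: power2_eq_square)
    finally have "y * (1 - y\<^sup>2 / 6) \<ge> y * (1 / 2)" using y by (intro mult_left_mono) auto
    moreover have "\<bar>sin y - y\<bar> \<le> y ^ 3 / 6"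
      using Maclaurin_sin_bound[of y 3] y by (simp add: eval_nat_numeral sin_coeff_def)
    hence "y - y ^ 3 / 6 \<le> sin y" by linarith
    ultimately show ?thesis by (simp add: algebra_simps power2_eq_square power3_eq_cube)
  qed
  have "\<bar>x\<bar> / 4 \<le> sin (\<bar>x\<bar> / 2)" using sin_ge[of "\<bar>x\<bar> / 2"] assms by simp
  hence "(\<bar>x\<bar> / 4)\<^sup>2 \<le> (sin (\<bar>x\<bar> / 2))\<^sup>2" by (intro power_mono) auto
  moreover have "cos x = 1 - 2 * (sin (\<bar>x\<bar> / 2))\<^sup>2"
    using cos_double_sin[of "\<bar>x\<bar> / 2"] by simp
  ultimately show ?thesis by (simp add: power_divide)
qed

context tasep_parameters
begin

definition parallel_count :: "nat \<Rightarrow> nat" where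
  "parallel_count n = (\<Sum>l=1..n. kappa a b l)"

text \<open>
  Each complete period contributes exactly \<open>b = \<Lambda> (a + b)\<close>, so only the last incomplete period causes an error.
\<close>
lemma parallel_count_asymp: "\<bar>real (parallel_count n) - \<Lambda> * real n\<bar> \<le> real (a + b)"
proof -
  define s where "s = a + b"
  have s: "s > 0" using ab unfolding s_def by linarith
  define f where "f = (\<lambda>i. if i mod s < a then 0 else 1 :: nat)"
  have f1: "f i \<le> 1" for i by (simp add: f_def)
  have period: "sum f {m * s..<m * s + s} = b" for m
  proof -
    have "sum f {m * s..<m * s + s} = sum (\<lambda>i. f (i + m * s)) {0..<s}"
      using sum.shift_bounds_nat_ivl[of f 0 "m * s" s] by (simp add: add.commute)
    also have "\<dots> = (\<Sum>i\<in>{0..<s}. if i < a then 0 else 1)"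
      by (intro sum.cong) (auto simp: f_def)
    also have "\<dots> = card {i \<in> {0..<s}. \<not> i < a}"
      by (subst sum.If_cases) (auto simp: Int_def)
    also have "{i \<in> {0..<s}. \<not> i < a} = {a..<s}" by auto
    finally show ?thesis by (simp add: s_def)
  qed
  define d r where "d = n div s" and "r = n mod s"
  have n: "n = d * s + r" and r: "r < s" using s by (auto simp: d_def r_def)
  have "parallel_count n = sum f {..<n}"
    unfolding parallel_count_def
    by (rule sum.reindex_bij_witness[of _ Suc "\<lambda>l. l - 1"]) (auto simp: kappa_def f_def s_def)
  also have "{..<n} = {..<d * s} \<union> {d * s..<d * s + r}" using n by auto
  also have "sum f ({..<d * s} \<union> {d * s..<d * s + r}) = sum f {..<d * s} + sum f {d * s..<d * s + r}"
    by (intro sum.union_disjoint) auto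
  also have "sum f {..<d * s} = d * b"
    using sum.nat_group[of f s d] by (simp add: period)
  finally have eq: "parallel_count n = d * b + sum f {d * s..<d * s + r}" .
  have "sum f {d * s..<d * s + r} \<le> (\<Sum>i\<in>{d * s..<d * s + r}. 1)" by (intro sum_mono f1)
  hence le: "sum f {d * s..<d * s + r} \<le> r" by simp
  have "\<Lambda> * real n = real (d * b) + \<Lambda> * real r"
    unfolding n using s by (simp add: lam_def s_def[symmetric] field_simps)
  hence *: "real (parallel_count n) - \<Lambda> * real n = real (sum f {d * s..<d * s + r}) - \<Lambda> * real r"
    unfolding eq by simp
  have "\<Lambda> * real r \<le> 1 * real r" using lam_bounds by (intro mult_right_mono) auto
  moreover have "0 \<le> \<Lambda> * real r" using lam_bounds by simp
  moreover have "real (sum f {d * s..<d * s + r}) \<le> real r" using le by (simp only: of_nat_le_iff)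
  moreover have "0 \<le> real (sum f {d * s..<d * s + r})" by (rule of_nat_0_le_iff)
  moreover have "real r \<le> real (a + b)" using r unfolding s_def by linarith
  ultimately show ?thesis unfolding * by linarith
qed

text \<open>
  The integrand of the kernel with all factors normalised to be \<open>1\<close> at \<open>w = \<theta>\<close>, except for \<open>1 / w\<close>.
  The factors \<open>1 + w\<close> from the denominators of the parallel particles are already cancelled
  against the time evolution.
\<close>
definition jump_integrand :: "nat \<Rightarrow> nat \<Rightarrow> int \<Rightarrow> complex \<Rightarrow> complex" where
  "jump_integrand k n m w =
     ((1 + w) / of_real (1 + \<theta>)) ^ k * ((of_real odds - w) / of_real (odds - \<theta>)) ^ n * (of_real \<theta> / w) powi m / w"

text \<open>
  Once the poles at \<open>- 1\<close> are cancelled, which takes \<open>t\<close> at least as large as the number of parallel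
  particles, the integrand is holomorphic away from \<open>0\<close>, and the radius may be increased beyond \<open>1\<close>. This matters
  since \<open>\<theta>\<close> need not be smaller than \<open>1\<close>.
\<close>
lemma kernel_S_eq_circle_integral:
  assumes r: "0 < r" "r < 1" and R: "0 < R" and t: "parallel_count n \<le> t"
  shows "of_real (1 / (1 + \<theta>) ^ t) * kernel_S p \<rho> a b r t n y x =
     1 / (2 * of_real pi * \<i>) * contour_integral (circlepath 0 R)
       (jump_integrand (t - parallel_count n) n (x - y + int n))"
proof -
  define K where "K = parallel_count n"
  define k where "k = t - K"
  define m where "m = x - y + int n"
  define J where "J = jump_integrand k n m"
  have tk: "t = k + K" using t by (simp add: k_def K_def)
  have th0: "of_real \<theta> \<noteq> (0::complex)" "of_real (1 + \<theta>) \<noteq> (0::complex)" "of_real (odds - \<theta>) \<noteq> (0::complex)"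
    using theta_pos theta_less_odds by (simp_all del: of_real_diff of_real_add)
  have prod_eq: "(\<Prod>l=1..n. (of_real odds - w) / (1 + w) ^ kappa a b l * of_real ((1 + \<theta>) ^ kappa a b l * \<theta> / (odds - \<theta>)))
     = ((of_real odds - w) / of_real (odds - \<theta>)) ^ n * of_real \<theta> ^ n * (of_real (1 + \<theta>) / (1 + w)) ^ K" for w :: complex
  proof -
    have "(\<Prod>l=1..n. (of_real odds - w) / (1 + w) ^ kappa a b l * of_real ((1 + \<theta>) ^ kappa a b l * \<theta> / (odds - \<theta>)))
      = (\<Prod>l=1..n. ((of_real odds - w) / of_real (odds - \<theta>) * of_real \<theta>) * (of_real (1 + \<theta>) / (1 + w)) ^ kappa a b l)"
      by (intro prod.cong refl) (simp only: power_divide of_real_mult of_real_divide of_real_power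
        times_divide_eq_left times_divide_eq_right divide_divide_eq_left mult_ac)
    also have "\<dots> = ((of_real odds - w) / of_real (odds - \<theta>) * of_real \<theta>) ^ n * (of_real (1 + \<theta>) / (1 + w)) ^ K"
      by (simp only: prod.distrib prod_constant card_atLeastAtMost diff_Suc_1 power_sum K_def parallel_count_def
          power_mult_distrib)
    finally show ?thesis by (simp only: power_mult_distrib)
  qed
  have integrand: "of_real (\<theta> powi (x - y)) / w powi (x - y + int n + 1) * (1 + w) ^ t *
            (\<Prod>l=1..n. (of_real odds - w) / (1 + w) ^ kappa a b l * of_real ((1 + \<theta>) ^ kappa a b l * \<theta> / (odds - \<theta>)))
          = of_real ((1 + \<theta>) ^ t) * J w" if w: "w \<noteq> 0" "1 + w \<noteq> 0" for w :: complex
  proof -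
    have 1: "of_real (\<theta> powi (x - y)) * of_real \<theta> ^ n = (of_real \<theta> powi m :: complex)"
      unfolding m_def using th0 by (simp add: power_int_add of_real_power_int)
    have 2: "w powi (x - y + int n + 1) = w powi m * w"
      unfolding m_def using w by (simp add: power_int_add)
    have 3: "(1 + w) ^ t * (of_real (1 + \<theta>) / (1 + w)) ^ K = of_real ((1 + \<theta>) ^ t) * ((1 + w) / of_real (1 + \<theta>)) ^ k"
      unfolding tk power_add power_divide of_real_power of_real_mult using w th0 by (simp add: field_simps)
    have "of_real (\<theta> powi (x - y)) / w powi (x - y + int n + 1) * (1 + w) ^ t *
          (((of_real odds - w) / of_real (odds - \<theta>)) ^ n * of_real \<theta> ^ n * (of_real (1 + \<theta>) / (1 + w)) ^ K)
        = (of_real (\<theta> powi (x - y)) * of_real \<theta> ^ n) / w powi (x - y + int n + 1) *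
          ((1 + w) ^ t * (of_real (1 + \<theta>) / (1 + w)) ^ K) * ((of_real odds - w) / of_real (odds - \<theta>)) ^ n"
      by (simp only: mult.assoc mult.commute mult.left_commute times_divide_eq_left times_divide_eq_right)
    also have "\<dots> = of_real ((1 + \<theta>) ^ t) * J w"
      unfolding 1 2 3 J_def jump_integrand_def power_int_divide_distrib
      by (simp only: mult.assoc mult.commute mult.left_commute times_divide_eq_left times_divide_eq_right divide_divide_eq_left)
    finally show ?thesis unfolding prod_eq .
  qed
  have holo: "J holomorphic_on (UNIV - {0})"
    unfolding J_def jump_integrand_def using th0 by (auto intro!: holomorphic_intros)
  have radius: "contour_integral (circlepath 0 r) J = contour_integral (circlepath 0 R) J"
  proof (cases "r \<le> R")
    case True
    show ?thesis
      using contour_integral_circlepath_eq(3)[OF open_UNIV holo r(1) True] by simp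
  next
    case False
    thus ?thesis
      using contour_integral_circlepath_eq(3)[OF open_UNIV holo R, of r] by simp
  qed
  have "kernel_S p \<rho> a b r t n y x = 1 / (2 * of_real pi * \<i>) *
     contour_integral (circlepath 0 r) (\<lambda>w. of_real ((1 + \<theta>) ^ t) * J w)"
    unfolding kernel_S_def Let_def odds_def[symmetric]
  proof (intro arg_cong[where f = "\<lambda>z. _ * z"] contour_integral_cong refl)
    fix w assume "w \<in> path_image (circlepath 0 r)"
    hence "norm w = r" using r by (simp add: path_image_circlepath_nonneg)
    hence "w \<noteq> 0" "1 + w \<noteq> 0"
      using r by (auto simp: add_eq_0_iff)
    from integrand[OF this]
    show "of_real (\<theta> powi (x - y)) / w powi (x - y + int n + 1) * (1 + w) ^ t *
            (\<Prod>l=1..n. (of_real odds - w) / (1 + w) ^ kappa a b l * of_real ((1 + \<theta>) ^ kappa a b l * \<theta> / (odds - \<theta>)))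
          = of_real ((1 + \<theta>) ^ t) * J w" .
  qed
  also have "contour_integral (circlepath 0 r) (\<lambda>w. of_real ((1 + \<theta>) ^ t) * J w) =
     of_real ((1 + \<theta>) ^ t) * contour_integral (circlepath 0 r) J"
  proof (intro contour_integral_lmul contour_integrable_holomorphic_simple[of _ "UNIV - {0}"])
    show "J holomorphic_on (UNIV - {0})" by (rule holo)
  qed (use r in \<open>auto simp: path_image_circlepath_nonneg\<close>)
  finally have kernel: "kernel_S p \<rho> a b r t n y x = 1 / (2 * of_real pi * \<i>) *
     (of_real ((1 + \<theta>) ^ t) * contour_integral (circlepath 0 R) J)"
    unfolding radius .
  have 1: "of_real (1 / (1 + \<theta>) ^ t) * of_real ((1 + \<theta>) ^ t) = (1 :: complex)"
  proof -
    have "1 / (1 + \<theta>) ^ t * (1 + \<theta>) ^ t = 1" using theta_pos by simp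
    thus ?thesis by (metis of_real_1 of_real_mult)
  qed
  have 2: "v * (A * (w * I)) = A * I" if "v * w = 1" for v w A I :: complex
  proof -
    have "v * (A * (w * I)) = (v * w) * (A * I)" by (simp only: mult_ac)
    thus ?thesis using that by simp
  qed
  show ?thesis
    unfolding kernel 2[OF 1] unfolding J_def k_def K_def m_def ..
qed

end

section \<open>Expansion at the double critical point\<close>

text \<open>
  A Taylor expansion obtained by integrating the expansion of the derivative: the difference of \<open>F\<close> and its leading term
  has a derivative of size \<open>o(|z|^k)\<close>. Applied to the phase it avoids second and third derivatives of
  logarithms, since the first derivative is a rational function of \<open>exp z\<close> in factored form.
\<close>
lemma tendsto_antiderivative_over_power:
  fixes F F' :: "complex \<Rightarrow> complex"
  assumes deriv: "\<forall>\<^sub>F z in nhds 0. (F has_field_derivative F' z) (at z)"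
    and F0: "F 0 = 0" "F' 0 = 0" and k: "k > 0"
    and lim: "((\<lambda>z. F' z / z ^ k) \<longlongrightarrow> A) (at 0)"
  shows "((\<lambda>z. F z / z ^ Suc k) \<longlongrightarrow> A / of_nat (Suc k)) (at 0)"
proof (rule tendstoI)
  fix e :: real assume e: "e > 0"
  define H where "H = (\<lambda>z. F z - A / of_nat (Suc k) * z ^ Suc k)"
  from deriv obtain d1 where d1: "d1 > 0" "\<And>z. norm z < d1 \<Longrightarrow> (F has_field_derivative F' z) (at z)"
    by (auto simp: eventually_nhds_metric dist_norm)
  from tendstoD[OF lim, of "e / 2"] e obtain d2 where d2: "d2 > 0"
      "\<And>z. z \<noteq> 0 \<Longrightarrow> norm z < d2 \<Longrightarrow> norm (F' z / z ^ k - A) < e / 2"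
    by (auto simp: eventually_at dist_norm)
  have *: "dist (F z / z ^ Suc k) (A / of_nat (Suc k)) < e" if z: "z \<noteq> 0" "norm z < min d1 d2" for z
  proof -
    have "norm (H z - H 0) \<le> e / 2 * norm z ^ k * norm (z - 0)"
    proof (rule field_differentiable_bound[where S = "closed_segment 0 z" and f' = "\<lambda>v. F' v - A * v ^ k"])
      fix v assume "v \<in> closed_segment 0 z"
      hence v: "norm v \<le> norm z"
        using segment_bound(1)[of v 0 z] by simp
      hence "(F has_field_derivative F' v) (at v within closed_segment 0 z)"
        using d1(2)[of v] z by (auto intro: has_field_derivative_at_within)
      moreover have "((\<lambda>z. A / of_nat (Suc k) * z ^ Suc k) has_field_derivative A * v ^ k) (at v within closed_segment 0 z)"
        by (rule derivative_eq_intros refl | simp del: of_nat_Suc)+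
      ultimately show "(H has_field_derivative F' v - A * v ^ k) (at v within closed_segment 0 z)"
        unfolding H_def by (rule DERIV_diff)
      show "norm (F' v - A * v ^ k) \<le> e / 2 * norm z ^ k"
      proof (cases "v = 0")
        case True
        thus ?thesis using F0 k e by (simp add: zero_power)
      next
        case False
        have "F' v - A * v ^ k = (F' v / v ^ k - A) * v ^ k" using False by (simp add: field_simps)
        hence "norm (F' v - A * v ^ k) = norm (F' v / v ^ k - A) * norm v ^ k"
          by (simp add: norm_mult norm_power)
        also have "\<dots> \<le> e / 2 * norm z ^ k"
          using d2(2)[OF False] v z e by (intro mult_mono power_mono) auto
        finally show ?thesis .
      qed
    qed auto
    hence "norm (H z) \<le> e / 2 * norm z ^ Suc k" by (simp add: H_def F0 mult_ac)
    moreover have "F z / z ^ Suc k - A / of_nat (Suc k) = H z / z ^ Suc k"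
      unfolding H_def using z by (simp add: diff_divide_distrib)
    ultimately have "norm (F z / z ^ Suc k - A / of_nat (Suc k)) \<le> e / 2"
      using z by (simp add: norm_divide norm_power norm_mult field_simps)
    thus ?thesis using e by (simp add: dist_norm)
  qed
  show "\<forall>\<^sub>F z in at 0. dist (F z / z ^ Suc k) (A / of_nat (Suc k)) < e"
    unfolding eventually_at using d1(1) d2(1) *
    by (intro exI[of _ "min d1 d2"]) (auto simp: dist_norm)
qed

context tasep_parameters
begin

lemma exp_difference: "of_real \<theta> * exp z - of_real \<theta> = of_real \<theta> * (exp z - 1 :: complex)"
  by (simp add: algebra_simps)

text \<open>
  The logarithms of the two factors of the integrand at \<open>w = \<theta> exp z\<close>. For \<open>z\<close> near \<open>0\<close> the argument of \<open>Ln\<close>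
  is near \<open>1\<close>, away from the branch cut.
\<close>
definition log_plus :: "complex \<Rightarrow> complex" where
  "log_plus z = Ln ((1 + of_real \<theta> * exp z) / of_real (1 + \<theta>))"

definition log_minus :: "complex \<Rightarrow> complex" where
  "log_minus z = Ln ((of_real odds - of_real \<theta> * exp z) / of_real (odds - \<theta>))"



lemma log_0: "log_plus 0 = 0" "log_minus 0 = 0"
proof -
  have "(1 + of_real \<theta>) / of_real (1 + \<theta>) = (1 :: complex)"
    using nonzero_of_real(1) by simp
  thus "log_plus 0 = 0" by (simp add: log_plus_def)
  have "(of_real odds - of_real \<theta>) / of_real (odds - \<theta>) = (1 :: complex)"
    using nonzero_of_real(2) by (simp only: of_real_diff[symmetric]) simp
  thus "log_minus 0 = 0" by (simp add: log_minus_def)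
qed

lemma eventually_in_slit_plane:
  "\<forall>\<^sub>F z in nhds 0. 0 < Re ((1 + of_real \<theta> * exp z) / of_real (1 + \<theta>))
                 \<and> 0 < Re ((of_real odds - of_real \<theta> * exp z) / of_real (odds - \<theta>))"
proof -
  have "((\<lambda>z. Re ((1 + of_real \<theta> * exp z) / of_real (1 + \<theta>))) \<longlongrightarrow> Re ((1 + of_real \<theta> * exp 0) / of_real (1 + \<theta>))) (nhds 0)"
    by (intro tendsto_intros filterlim_ident nonzero_of_real)
  moreover have "Re ((1 + of_real \<theta> * exp 0) / of_real (1 + \<theta>)) > 0"
    using theta_pos by (simp only: Re_divide_of_real) simp
  moreover have "((\<lambda>z. Re ((of_real odds - of_real \<theta> * exp z) / of_real (odds - \<theta>))) \<longlongrightarrow> Re ((of_real odds - of_real \<theta> * exp 0) / of_real (odds - \<theta>))) (nhds 0)"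
    by (intro tendsto_intros filterlim_ident nonzero_of_real)
  moreover have "Re ((of_real odds - of_real \<theta> * exp 0) / of_real (odds - \<theta>)) > 0"
    using theta_less_odds by (simp only: Re_divide_of_real minus_complex.simps Re_complex_of_real exp_zero mult_1_right) simp
  ultimately show ?thesis
    by (intro eventually_conj order_tendstoD(1))
qed

lemma log_derivs:
  assumes "0 < Re ((1 + of_real \<theta> * exp z) / of_real (1 + \<theta>))"
    and "0 < Re ((of_real odds - of_real \<theta> * exp z) / of_real (odds - \<theta>))"
  shows "(log_plus has_field_derivative (of_real \<theta> * exp z) / (1 + of_real \<theta> * exp z)) (at z)"
    and "(log_minus has_field_derivative - ((of_real \<theta> * exp z) / (of_real odds - of_real \<theta> * exp z))) (at z)"
    and "1 + of_real \<theta> * exp z \<noteq> 0" "of_real odds - of_real \<theta> * exp z \<noteq> 0"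
proof -
  show nz: "1 + of_real \<theta> * exp z \<noteq> 0" "of_real odds - of_real \<theta> * exp z \<noteq> 0"
  proof -
    show "1 + of_real \<theta> * exp z \<noteq> 0"
      using assms(1) by (rule contrapos_pn) (simp only: div_0 zero_complex.simps less_irrefl not_False_eq_True)
    show "of_real odds - of_real \<theta> * exp z \<noteq> 0"
      using assms(2) by (rule contrapos_pn) (simp only: div_0 zero_complex.simps less_irrefl not_False_eq_True)
  qed
  have slit: "(1 + of_real \<theta> * exp z) / of_real (1 + \<theta>) \<notin> \<real>\<^sub>\<le>\<^sub>0"
       "(of_real odds - of_real \<theta> * exp z) / of_real (odds - \<theta>) \<notin> \<real>\<^sub>\<le>\<^sub>0"
    using assms by (simp_all only: complex_nonpos_Reals_iff not_le[symmetric] simp_thms)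
  have inv: "inverse (a / b) * (c / b) = c / a" if "a \<noteq> 0" "b \<noteq> 0" for a b c :: complex
    using that by simp
  have 1: "((\<lambda>z. (1 + of_real \<theta> * exp z) / of_real (1 + \<theta>)) has_field_derivative of_real \<theta> * exp z / of_real (1 + \<theta>)) (at z)"
    by (rule DERIV_cdivide) (auto intro!: derivative_eq_intros)
  have 2: "((\<lambda>z. (of_real odds - of_real \<theta> * exp z) / of_real (odds - \<theta>)) has_field_derivative - (of_real \<theta> * exp z) / of_real (odds - \<theta>)) (at z)"
    by (rule DERIV_cdivide) (auto intro!: derivative_eq_intros)
  show "(log_plus has_field_derivative (of_real \<theta> * exp z) / (1 + of_real \<theta> * exp z)) (at z)"
    using DERIV_chain2[OF has_field_derivative_Ln[OF slit(1)] 1] inv[OF nz(1) nonzero_of_real(1)]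
    unfolding log_plus_def[abs_def] by simp
  show "(log_minus has_field_derivative - ((of_real \<theta> * exp z) / (of_real odds - of_real \<theta> * exp z))) (at z)"
    using DERIV_chain2[OF has_field_derivative_Ln[OF slit(2)] 2] inv[OF nz(2) nonzero_of_real(2)]
    unfolding log_minus_def[abs_def] by simp
qed

lemma log_tendsto_0: "(log_plus \<longlongrightarrow> 0) (at 0)" "(log_minus \<longlongrightarrow> 0) (at 0)"
  using log_derivs(1,2)[THEN DERIV_isCont, of 0] eventually_nhds_x_imp_x[OF eventually_in_slit_plane]
  by (auto simp: isCont_def log_0)

lemma cubic_expansion:
  "((\<lambda>z. (of_real (1 - \<Lambda> * \<alpha>) * log_plus z + of_real \<alpha> * log_minus z - of_real (\<alpha> + \<beta>) * z) / z ^ 3)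
      \<longlongrightarrow> - of_real cubic_coeff / 3) (at 0)"
proof -
  define F' where "F' = (\<lambda>z. - of_real p * (of_real \<theta> * exp z - of_real \<theta>)\<^sup>2 /
      (of_real denom * (1 + of_real \<theta> * exp z) * (of_real odds - of_real \<theta> * exp z)) :: complex)"
  have "((\<lambda>z. (of_real (1 - \<Lambda> * \<alpha>) * log_plus z + of_real \<alpha> * log_minus z - of_real (\<alpha> + \<beta>) * z) / z ^ Suc 2)
      \<longlongrightarrow> - of_real cubic_coeff / of_nat (Suc 2)) (at 0)"
  proof (rule tendsto_antiderivative_over_power[where F' = F'])
    show "\<forall>\<^sub>F z in nhds 0. ((\<lambda>z. of_real (1 - \<Lambda> * \<alpha>) * log_plus z + of_real \<alpha> * log_minus z - of_real (\<alpha> + \<beta>) * z)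
             has_field_derivative F' z) (at z)"
      using eventually_in_slit_plane
    proof eventually_elim
      case (elim z)
      note d = log_derivs[OF elim[THEN conjunct1] elim[THEN conjunct2]]
      have "((\<lambda>z. of_real (1 - \<Lambda> * \<alpha>) * log_plus z + of_real \<alpha> * log_minus z - of_real (\<alpha> + \<beta>) * z)
             has_field_derivative (of_real (1 - \<Lambda> * \<alpha>) * (of_real \<theta> * exp z / (1 + of_real \<theta> * exp z))
              + of_real \<alpha> * (- (of_real \<theta> * exp z / (of_real odds - of_real \<theta> * exp z))) - of_real (\<alpha> + \<beta>) * 1)) (at z)"
        by (intro DERIV_add DERIV_diff DERIV_cmult d DERIV_ident)
      thus ?case
        unfolding F'_def critical_slope[OF d(3,4), symmetric] by simp
    qed
    have "((\<lambda>z. - of_real p * of_real \<theta> ^ 2 * ((exp z - 1) / z)\<^sup>2 /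
      (of_real denom * (1 + of_real \<theta> * exp z) * (of_real odds - of_real \<theta> * exp z))) \<longlongrightarrow>
       - of_real p * of_real \<theta> ^ 2 * 1\<^sup>2 / (of_real denom * (1 + of_real \<theta> * exp 0) * (of_real odds - of_real \<theta> * exp 0))) (at (0::complex))"
      using denom_pos nonzero_of_real
      by (intro tendsto_intros lim_exp_minus_1) (auto simp: add_eq_0_iff)
    also have "- of_real p * of_real \<theta> ^ 2 * 1\<^sup>2 / (of_real denom * (1 + of_real \<theta> * exp 0) * (of_real odds - of_real \<theta> * exp 0))
        = (- of_real cubic_coeff :: complex)"
      unfolding cubic_coeff_eq by simp
    finally show "((\<lambda>z. F' z / z ^ 2) \<longlongrightarrow> - of_real cubic_coeff) (at 0)"
      by (rule Lim_transform_eventually)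
         (intro always_eventually allI, unfold F'_def exp_difference, simp add: power_divide power_mult_distrib mult_ac)
  qed (auto simp: F'_def log_0)
  thus ?thesis by (simp add: eval_nat_numeral)
qed

lemma quadratic_expansion:
  "((\<lambda>z. (of_real \<Lambda> * log_plus z - log_minus z - of_real (1 / \<rho> - 1) * z) / z ^ 2)
      \<longlongrightarrow> of_real (\<gamma>\<^sup>2)) (at 0)"
proof -
  define F' where "F' = (\<lambda>z. (of_real \<theta> * exp z - of_real \<theta>) *
      (of_real \<Lambda> / ((1 + of_real \<theta> * exp z) * of_real (1 + \<theta>)) +
       of_real odds / ((of_real odds - of_real \<theta> * exp z) * of_real (odds - \<theta>))) :: complex)"
  have "((\<lambda>z. (of_real \<Lambda> * log_plus z - log_minus z - of_real (1 / \<rho> - 1) * z) / z ^ Suc 1)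
      \<longlongrightarrow> of_real (2 * \<gamma>\<^sup>2) / of_nat (Suc 1)) (at 0)"
  proof (rule tendsto_antiderivative_over_power[where F' = F'])
    show "\<forall>\<^sub>F z in nhds 0. ((\<lambda>z. of_real \<Lambda> * log_plus z - log_minus z - of_real (1 / \<rho> - 1) * z)
             has_field_derivative F' z) (at z)"
      using eventually_in_slit_plane
    proof eventually_elim
      case (elim z)
      note d = log_derivs[OF elim[THEN conjunct1] elim[THEN conjunct2]]
      have "((\<lambda>z. of_real \<Lambda> * log_plus z - log_minus z - of_real (1 / \<rho> - 1) * z)
             has_field_derivative (of_real \<Lambda> * (of_real \<theta> * exp z / (1 + of_real \<theta> * exp z))
              - (- (of_real \<theta> * exp z / (of_real odds - of_real \<theta> * exp z))) - of_real (1 / \<rho> - 1) * 1)) (at z)"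
        by (intro DERIV_add DERIV_diff DERIV_cmult d DERIV_ident)
      thus ?case
        unfolding F'_def density_slope[OF d(3,4), symmetric] by simp
    qed
    have "((\<lambda>z. of_real \<theta> * ((exp z - 1) / z) *
      (of_real \<Lambda> / ((1 + of_real \<theta> * exp z) * of_real (1 + \<theta>)) +
       of_real odds / ((of_real odds - of_real \<theta> * exp z) * of_real (odds - \<theta>)))) \<longlongrightarrow>
       of_real \<theta> * 1 * (of_real \<Lambda> / ((1 + of_real \<theta> * exp 0) * of_real (1 + \<theta>)) +
       of_real odds / ((of_real odds - of_real \<theta> * exp 0) * of_real (odds - \<theta>)))) (at (0::complex))"
      using nonzero_of_real
      by (intro tendsto_intros lim_exp_minus_1) (auto simp: add_eq_0_iff)
    also have "of_real \<theta> * 1 * (of_real \<Lambda> / ((1 + of_real \<theta> * exp 0) * of_real (1 + \<theta>)) +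
       of_real odds / ((of_real odds - of_real \<theta> * exp 0) * of_real (odds - \<theta>))) = (of_real (2 * \<gamma>\<^sup>2) :: complex)"
      unfolding two_gam_square by (simp add: power2_eq_square)
    finally show "((\<lambda>z. F' z / z ^ 1) \<longlongrightarrow> of_real (2 * \<gamma>\<^sup>2)) (at 0)"
      by (rule Lim_transform_eventually)
         (simp add: F'_def exp_difference)
  qed (auto simp: F'_def log_0)
  thus ?thesis by (simp add: eval_nat_numeral)
qed

end

section \<open>Pointwise convergence in the scaling window\<close>

text \<open>This disposes of the rounding errors, which are bounded but have no limit.\<close>
lemma bounded_times_null:
  fixes f :: "real \<Rightarrow> 'b :: real_normed_algebra_1"
  assumes "\<forall>\<^sub>F \<epsilon> in F. \<bar>e \<epsilon>\<bar> \<le> B" "(f \<longlongrightarrow> 0) F"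
  shows "((\<lambda>\<epsilon>. of_real (e \<epsilon>) * f \<epsilon>) \<longlongrightarrow> 0) F"
proof (rule Lim_null_comparison)
  show "\<forall>\<^sub>F \<epsilon> in F. norm (of_real (e \<epsilon>) * f \<epsilon>) \<le> B * norm (f \<epsilon>)"
    using assms(1)
  proof eventually_elim
    case (elim \<epsilon>)
    have "norm (of_real (e \<epsilon>) * f \<epsilon>) \<le> norm (of_real (e \<epsilon>) :: 'b) * norm (f \<epsilon>)"
      by (rule norm_mult_ineq)
    also have "\<dots> \<le> B * norm (f \<epsilon>)" using elim by (intro mult_right_mono) auto
    finally show ?case .
  qed
  show "((\<lambda>\<epsilon>. B * norm (f \<epsilon>)) \<longlongrightarrow> 0) F"
    using tendsto_mult[OF tendsto_const[of B] tendsto_norm[OF assms(2)]] by simp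
qed

lemma filterlim_scales_at_top:
  fixes A B C :: real
  assumes "A > 0"
  shows "filterlim (\<lambda>\<epsilon>. A * \<epsilon> powr (-3/2) + B * \<epsilon> powr (-1) + C) at_top (at_right 0)"
  using assms by real_asymp

locale scaling = tasep_parameters +
  fixes T X :: real
  assumes T_pos: "0 < T"
begin

text \<open>
  \<open>mesh\<close> is the factor \<open>\<eta>\<close> between the logarithm of \<open>w / \<theta>\<close> and the scaled variable. \<open>surplus\<close> is the exponent
  of \<open>1 + w\<close> in the integrand, and \<open>drift\<close> is the exponent of \<open>\<theta> / w\<close> without the contribution of \<open>\<zeta>\<close> and \<open>u\<close>
  and without rounding of the positions.
\<close>
definition mesh :: "real \<Rightarrow> real" where "mesh \<epsilon> = sqrt \<epsilon> / (\<gamma> * \<sigma>)"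
definition time_scale :: "real \<Rightarrow> real" where "time_scale \<epsilon> = \<epsilon> powr (-3/2) * T"
definition label_shift :: "real \<Rightarrow> real" where "label_shift \<epsilon> = \<sigma>\<^sup>2 * \<epsilon> powr (-1) * X"
definition steps :: "real \<Rightarrow> nat" where "steps \<epsilon> = nat \<lfloor>time_scale \<epsilon>\<rfloor>"
definition label :: "real \<Rightarrow> nat" where "label \<epsilon> = nat \<lfloor>\<alpha> * time_scale \<epsilon> - label_shift \<epsilon>\<rfloor>"
definition surplus :: "real \<Rightarrow> nat" where "surplus \<epsilon> = steps \<epsilon> - parallel_count (label \<epsilon>)"
definition drift :: "real \<Rightarrow> real" where "drift \<epsilon> = real (label \<epsilon>) + \<beta> * time_scale \<epsilon> + label_shift \<epsilon> / \<rho>"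

text \<open>The part of the integrand that does not involve \<open>\<zeta>\<close> and \<open>u\<close>, in the scaled variable.\<close>
definition profile :: "real \<Rightarrow> complex \<Rightarrow> complex" where
  "profile \<epsilon> w = ((1 + of_real \<theta> * exp (- (of_real (mesh \<epsilon>) * w))) / of_real (1 + \<theta>)) ^ surplus \<epsilon>
     * ((of_real odds - of_real \<theta> * exp (- (of_real (mesh \<epsilon>) * w))) / of_real (odds - \<theta>)) ^ label \<epsilon>
     * exp (of_real (drift \<epsilon>) * (of_real (mesh \<epsilon>) * w))"

lemma mesh_pos: "0 < \<epsilon> \<Longrightarrow> 0 < mesh \<epsilon>"
  using gam_pos sigma_pos by (simp add: mesh_def)

lemma mesh_tendsto_0: "(mesh \<longlongrightarrow> 0) (at_right 0)"
proof -
  have "((\<lambda>\<epsilon>. sqrt \<epsilon> / (\<gamma> * \<sigma>)) \<longlongrightarrow> sqrt 0 / (\<gamma> * \<sigma>)) (at_right 0)"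
    using gam_pos sigma_pos by (intro tendsto_intros) auto
  thus ?thesis by (simp add: mesh_def[abs_def])
qed

lemma time_scale_mesh: "0 < \<epsilon> \<Longrightarrow> time_scale \<epsilon> = T / (cubic_coeff * mesh \<epsilon> ^ 3)"
proof -
  assume e: "0 < \<epsilon>"
  have "\<epsilon> powr (-3/2) = 1 / sqrt \<epsilon> ^ 3"
    using e by (simp add: powr_half_sqrt[symmetric] powr_power powr_minus_divide)
  moreover have "cubic_coeff * mesh \<epsilon> ^ 3 = sqrt \<epsilon> ^ 3"
    using cubic_coeff_pos unfolding mesh_def power_divide gam_sigma_cubed by simp
  ultimately show ?thesis by (simp add: time_scale_def)
qed

lemma label_shift_mesh: "0 < \<epsilon> \<Longrightarrow> label_shift \<epsilon> = X / (\<gamma>\<^sup>2 * mesh \<epsilon> ^ 2)"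
  using gam_pos sigma_pos by (simp add: label_shift_def mesh_def power_divide power_mult_distrib powr_minus_divide)

text \<open>
  The inequality between the counts is the point where \<open>\<Lambda> \<alpha> < 1\<close> enters: the time grows faster than the number of parallel
  particles. It also makes the truncated subtraction in \<open>surplus\<close> a true one.
\<close>
lemma rounding_errors:
  "\<forall>\<^sub>F \<epsilon> in at_right 0. parallel_count (label \<epsilon>) \<le> steps \<epsilon>
     \<and> \<bar>real (label \<epsilon>) - (\<alpha> * time_scale \<epsilon> - label_shift \<epsilon>)\<bar> \<le> real (a + b) + 2
     \<and> \<bar>real (surplus \<epsilon>) - ((1 - \<Lambda> * \<alpha>) * time_scale \<epsilon> + \<Lambda> * label_shift \<epsilon>)\<bar> \<le> real (a + b) + 2"
proof -
  define s where "s = real (a + b)"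
  have large: "\<forall>\<^sub>F \<epsilon> in at_right 0. 0 \<le> A * time_scale \<epsilon> + B * label_shift \<epsilon> + C" if "A > 0" for A B C
  proof -
    have "filterlim (\<lambda>\<epsilon>. (A * T) * \<epsilon> powr (-3/2) + (B * \<sigma>\<^sup>2 * X) * \<epsilon> powr (-1) + C) at_top (at_right 0)"
      using that T_pos by (intro filterlim_scales_at_top) auto
    hence "filterlim (\<lambda>\<epsilon>. A * time_scale \<epsilon> + B * label_shift \<epsilon> + C) at_top (at_right 0)"
      by (simp only: time_scale_def label_shift_def mult_ac)
    thus ?thesis by (simp add: filterlim_at_top)
  qed
  have "\<forall>\<^sub>F \<epsilon> in at_right 0. 0 \<le> \<alpha> * time_scale \<epsilon> - label_shift \<epsilon>"
    using large[OF alpha_pos, of "-1" 0] by simp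
  moreover have "\<forall>\<^sub>F \<epsilon> in at_right 0. 0 \<le> (1 - \<Lambda> * \<alpha>) * time_scale \<epsilon> + \<Lambda> * label_shift \<epsilon> - (s + 2)"
    by (rule eventually_mono[OF large[OF one_minus_lam_alpha_pos, of \<Lambda> "- (s + 2)"]]) linarith
  ultimately show ?thesis
    using eventually_at_right_less[of 0]
  proof eventually_elim
    case (elim \<epsilon>)
    have time_scale: "0 \<le> time_scale \<epsilon>" using T_pos by (simp add: time_scale_def)
    have t: "\<bar>real (steps \<epsilon>) - time_scale \<epsilon>\<bar> \<le> 1"
      unfolding steps_def using time_scale by linarith
    have n: "\<bar>real (label \<epsilon>) - (\<alpha> * time_scale \<epsilon> - label_shift \<epsilon>)\<bar> \<le> 1"
      unfolding label_def using elim(1) by linarith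
    define e1 where "e1 = real (label \<epsilon>) - (\<alpha> * time_scale \<epsilon> - label_shift \<epsilon>)"
    define e2 where "e2 = real (steps \<epsilon>) - time_scale \<epsilon>"
    define e3 where "e3 = real (parallel_count (label \<epsilon>)) - \<Lambda> * real (label \<epsilon>)"
    have e3: "\<bar>e3\<bar> \<le> s" unfolding e3_def s_def by (rule parallel_count_asymp)
    have e1: "\<bar>\<Lambda> * e1\<bar> \<le> 1"
      using n lam_bounds unfolding e1_def[symmetric] abs_mult by (intro mult_le_one) auto
    have eq: "real (steps \<epsilon>) - real (parallel_count (label \<epsilon>))
        = (1 - \<Lambda> * \<alpha>) * time_scale \<epsilon> + \<Lambda> * label_shift \<epsilon> + (e2 - e3 - \<Lambda> * e1)"
      unfolding e1_def e2_def e3_def by (simp add: algebra_simps)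
    have bd: "\<bar>e2 - e3 - \<Lambda> * e1\<bar> \<le> s + 2" using e1 e3 t unfolding e2_def[symmetric] by linarith
    have le: "parallel_count (label \<epsilon>) \<le> steps \<epsilon>"
      using eq bd elim(2) by linarith
    hence "real (surplus \<epsilon>) = real (steps \<epsilon>) - real (parallel_count (label \<epsilon>))"
      by (simp add: surplus_def of_nat_diff)
    thus ?case using le n bd eq unfolding s_def by auto
  qed
qed

text \<open>
  The exponent splits into \<open>time_scale\<close> times a function of order \<open>z^3\<close>, \<open>label_shift\<close> times a function of order \<open>z^2\<close>, and
  bounded rounding errors times functions that vanish at \<open>0\<close>. With \<open>z\<close> of order \<open>sqrt \<epsilon>\<close> the first two
  have finite limits, and the errors disappear.
\<close>
lemma profile_tendsto:
  "((\<lambda>\<epsilon>. profile \<epsilon> w) \<longlongrightarrow> exp (of_real T * w ^ 3 / 3 + of_real X * w ^ 2)) (at_right 0)"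
proof (cases "w = 0")
  case True
  have "profile \<epsilon> w = 1" for \<epsilon>
    using nonzero_of_real True by (simp add: profile_def)
  thus ?thesis using True by simp
next
  case w: False
  define z where "z = (\<lambda>\<epsilon>. - (of_real (mesh \<epsilon>) * w))"
  have pos: "\<forall>\<^sub>F \<epsilon>::real in at_right 0. 0 < \<epsilon>" by (rule eventually_at_right_less)
  have z0: "(z \<longlongrightarrow> 0) (at_right 0)"
  proof -
    have "((\<lambda>\<epsilon>. - (of_real (mesh \<epsilon>) * w)) \<longlongrightarrow> - (of_real 0 * w)) (at_right 0)"
      by (intro tendsto_intros mesh_tendsto_0)
    thus ?thesis by (simp add: z_def)
  qed
  have z: "filterlim z (at 0) (at_right 0)"
    unfolding filterlim_at using z0 pos
    by (auto elim!: eventually_mono simp: z_def w dest: mesh_pos)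
  define cubic where "cubic = (\<lambda>z. of_real (1 - \<Lambda> * \<alpha>) * log_plus z + of_real \<alpha> * log_minus z - of_real (\<alpha> + \<beta>) * z)"
  define quad where "quad = (\<lambda>z. of_real \<Lambda> * log_plus z - log_minus z - of_real (1 / \<rho> - 1) * z)"
  define e1 where "e1 = (\<lambda>\<epsilon>. real (surplus \<epsilon>) - ((1 - \<Lambda> * \<alpha>) * time_scale \<epsilon> + \<Lambda> * label_shift \<epsilon>))"
  define e2 where "e2 = (\<lambda>\<epsilon>. real (label \<epsilon>) - (\<alpha> * time_scale \<epsilon> - label_shift \<epsilon>))"
  have a1: "((\<lambda>\<epsilon>. - of_real T * w ^ 3 / of_real cubic_coeff * (cubic (z \<epsilon>) / z \<epsilon> ^ 3)) \<longlongrightarrow> - of_real T * w ^ 3 / of_real cubic_coeff * (- of_real cubic_coeff / 3)) (at_right 0)"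
    unfolding cubic_def by (intro tendsto_mult tendsto_const filterlim_compose[OF cubic_expansion z])
  have b1: "\<forall>\<^sub>F \<epsilon> in at_right 0. - of_real T * w ^ 3 / of_real cubic_coeff * (cubic (z \<epsilon>) / z \<epsilon> ^ 3) = of_real (time_scale \<epsilon>) * cubic (z \<epsilon>)"
    using pos
  proof eventually_elim
    case (elim \<epsilon>)
    have "z \<epsilon> ^ 3 = - (of_real (mesh \<epsilon>) ^ 3 * w ^ 3)" by (simp add: z_def power_mult_distrib)
    thus ?case unfolding time_scale_mesh[OF elim] using w mesh_pos[OF elim] by simp
  qed
  have c1: "- of_real T * w ^ 3 / of_real cubic_coeff * (- of_real cubic_coeff / 3) = of_real T * w ^ 3 / 3"
    using cubic_coeff_pos by simp
  have lim1: "((\<lambda>\<epsilon>. of_real (time_scale \<epsilon>) * cubic (z \<epsilon>)) \<longlongrightarrow> of_real T * w ^ 3 / 3) (at_right 0)"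
    using Lim_transform_eventually[OF a1 b1] unfolding c1 .
  have a2: "((\<lambda>\<epsilon>. of_real X * w ^ 2 / of_real (\<gamma>\<^sup>2) * (quad (z \<epsilon>) / z \<epsilon> ^ 2)) \<longlongrightarrow> of_real X * w ^ 2 / of_real (\<gamma>\<^sup>2) * of_real (\<gamma>\<^sup>2)) (at_right 0)"
    unfolding quad_def by (intro tendsto_mult tendsto_const filterlim_compose[OF quadratic_expansion z])
  have b2: "\<forall>\<^sub>F \<epsilon> in at_right 0. of_real X * w ^ 2 / of_real (\<gamma>\<^sup>2) * (quad (z \<epsilon>) / z \<epsilon> ^ 2) = of_real (label_shift \<epsilon>) * quad (z \<epsilon>)"
    using pos
  proof eventually_elim
    case (elim \<epsilon>)
    have "z \<epsilon> ^ 2 = of_real (mesh \<epsilon>) ^ 2 * w ^ 2" by (simp add: z_def power_mult_distrib)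
    thus ?case unfolding label_shift_mesh[OF elim] using w mesh_pos[OF elim] by simp
  qed
  have c2: "of_real X * w ^ 2 / of_real (\<gamma>\<^sup>2) * of_real (\<gamma>\<^sup>2) = of_real X * w ^ 2"
    using gam_pos by simp
  have lim2: "((\<lambda>\<epsilon>. of_real (label_shift \<epsilon>) * quad (z \<epsilon>)) \<longlongrightarrow> of_real X * w ^ 2) (at_right 0)"
    using Lim_transform_eventually[OF a2 b2] unfolding c2 .
  have e1: "\<forall>\<^sub>F \<epsilon> in at_right 0. \<bar>e1 \<epsilon>\<bar> \<le> real (a + b) + 2"
    and e2: "\<forall>\<^sub>F \<epsilon> in at_right 0. \<bar>e2 \<epsilon>\<bar> \<le> real (a + b) + 2"
    using rounding_errors unfolding e1_def e2_def by (auto elim: eventually_mono)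
  have lim3: "((\<lambda>\<epsilon>. of_real (e1 \<epsilon>) * log_plus (z \<epsilon>)) \<longlongrightarrow> 0) (at_right 0)"
    by (intro bounded_times_null[OF e1] filterlim_compose[OF log_tendsto_0(1) z])
  have lim4: "((\<lambda>\<epsilon>. of_real (e2 \<epsilon>) * log_minus (z \<epsilon>)) \<longlongrightarrow> 0) (at_right 0)"
    by (intro bounded_times_null[OF e2] filterlim_compose[OF log_tendsto_0(2) z])
  have lim5: "((\<lambda>\<epsilon>. of_real (e2 \<epsilon>) * z \<epsilon>) \<longlongrightarrow> 0) (at_right 0)"
    by (intro bounded_times_null[OF e2] z0)
  have a3: "((\<lambda>\<epsilon>. exp (of_real (time_scale \<epsilon>) * cubic (z \<epsilon>) + of_real (label_shift \<epsilon>) * quad (z \<epsilon>)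
          + of_real (e1 \<epsilon>) * log_plus (z \<epsilon>) + of_real (e2 \<epsilon>) * log_minus (z \<epsilon>) - of_real (e2 \<epsilon>) * z \<epsilon>))
      \<longlongrightarrow> exp (of_real T * w ^ 3 / 3 + of_real X * w ^ 2 + 0 + 0 - 0)) (at_right 0)"
    by (intro tendsto_exp tendsto_add tendsto_diff lim1 lim2 lim3 lim4 lim5)
  have b3: "\<forall>\<^sub>F \<epsilon> in at_right 0. exp (of_real (time_scale \<epsilon>) * cubic (z \<epsilon>) + of_real (label_shift \<epsilon>) * quad (z \<epsilon>)
          + of_real (e1 \<epsilon>) * log_plus (z \<epsilon>) + of_real (e2 \<epsilon>) * log_minus (z \<epsilon>) - of_real (e2 \<epsilon>) * z \<epsilon>)
        = profile \<epsilon> w"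
    using eventually_compose_filterlim[OF eventually_in_slit_plane z0]
  proof eventually_elim
    case (elim \<epsilon>)
    have nz: "(1 + of_real \<theta> * exp (z \<epsilon>)) / of_real (1 + \<theta>) \<noteq> 0"
      "(of_real odds - of_real \<theta> * exp (z \<epsilon>)) / of_real (odds - \<theta>) \<noteq> 0"
      using log_derivs(3,4)[OF elim[THEN conjunct1] elim[THEN conjunct2]] nonzero_of_real
      by (simp_all only: divide_eq_0_iff simp_thms)
    have "of_real (time_scale \<epsilon>) * cubic (z \<epsilon>) + of_real (label_shift \<epsilon>) * quad (z \<epsilon>)
          + of_real (e1 \<epsilon>) * log_plus (z \<epsilon>) + of_real (e2 \<epsilon>) * log_minus (z \<epsilon>) - of_real (e2 \<epsilon>) * z \<epsilon>
        = of_nat (surplus \<epsilon>) * log_plus (z \<epsilon>) + of_nat (label \<epsilon>) * log_minus (z \<epsilon>) + of_real (drift \<epsilon>) * (- z \<epsilon>)"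
      unfolding cubic_def quad_def e1_def e2_def drift_def by (simp add: algebra_simps)
    hence "exp (of_real (time_scale \<epsilon>) * cubic (z \<epsilon>) + of_real (label_shift \<epsilon>) * quad (z \<epsilon>)
          + of_real (e1 \<epsilon>) * log_plus (z \<epsilon>) + of_real (e2 \<epsilon>) * log_minus (z \<epsilon>) - of_real (e2 \<epsilon>) * z \<epsilon>)
        = exp (log_plus (z \<epsilon>)) ^ surplus \<epsilon> * exp (log_minus (z \<epsilon>)) ^ label \<epsilon> * exp (of_real (drift \<epsilon>) * (- z \<epsilon>))"
      by (simp only: exp_add exp_of_nat_mult)
    also have "\<dots> = profile \<epsilon> w"
      unfolding profile_def log_plus_def log_minus_def exp_Ln[OF nz(1)] exp_Ln[OF nz(2)] by (simp add: z_def)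
    finally show ?case .
  qed
  show ?thesis using Lim_transform_eventually[OF a3 b3] by (simp only: add_0_right diff_0_right)
qed

end

section \<open>Gaussian domination on the circle\<close>

text \<open>
  The bounds for the two factors have exponents with the same dependence on \<open>\<phi>\<close>, so a single
  number, the bracket, controls the decay away from angle \<open>0\<close> on the whole circle.
\<close>
lemma norm_product_on_circle:
  fixes R Q \<phi> :: real
  assumes R: "0 < R" "R < Q"
  shows "norm (1 + of_real R * cis \<phi>) ^ k * norm (of_real Q - of_real R * cis \<phi>) ^ n
    \<le> (1 + R) ^ k * (Q - R) ^ n * exp (R * (1 - cos \<phi>) * (real n * Q / (Q - R)\<^sup>2 - real k / (1 + R)\<^sup>2))"
proof -
  have 1: "norm (1 + of_real R * cis \<phi>) \<le> (1 + R) * exp (- (R * (1 - cos \<phi>) / (1 + R)\<^sup>2))"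
    using norm_one_plus_circle[of R \<phi>] R by simp
  have "norm (of_real Q - of_real R * cis \<phi>) = Q * norm (1 + of_real (- (R / Q)) * cis \<phi>)"
  proof -
    have "of_real Q - of_real R * cis \<phi> = of_real Q * (1 + of_real (- (R / Q)) * cis \<phi>)"
      using R by (simp add: field_simps)
    thus ?thesis using R by (simp add: norm_mult del: of_real_minus of_real_divide)
  qed
  also have "\<dots> \<le> Q * (\<bar>1 + (- (R / Q))\<bar> * exp (- (- (R / Q) * (1 - cos \<phi>) / (1 + (- (R / Q)))\<^sup>2)))"
    using R by (intro mult_left_mono norm_one_plus_circle) (auto simp: field_simps)
  also have "\<dots> = (Q - R) * exp (R * (1 - cos \<phi>) * Q / (Q - R)\<^sup>2)"
  proof -
    have "Q * \<bar>1 + (- (R / Q))\<bar> = Q - R" using R by (simp add: field_simps abs_if)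
    moreover have "(1 + (- (R / Q)))\<^sup>2 = (Q - R)\<^sup>2 / Q\<^sup>2" using R by (simp add: power_divide[symmetric] diff_divide_distrib)
    moreover have "- (- (R / Q) * v / ((Q - R)\<^sup>2 / Q\<^sup>2)) = R * v * Q / (Q - R)\<^sup>2" for v
      using R by (simp add: power2_eq_square)
    ultimately show ?thesis by (simp only: mult.assoc[symmetric])
  qed
  finally have 2: "norm (of_real Q - of_real R * cis \<phi>) \<le> (Q - R) * exp (R * (1 - cos \<phi>) * Q / (Q - R)\<^sup>2)" .
  have "norm (1 + of_real R * cis \<phi>) ^ k * norm (of_real Q - of_real R * cis \<phi>) ^ n
     \<le> ((1 + R) * exp (- (R * (1 - cos \<phi>) / (1 + R)\<^sup>2))) ^ k * ((Q - R) * exp (R * (1 - cos \<phi>) * Q / (Q - R)\<^sup>2)) ^ n"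
    using 1 2 R by (intro mult_mono power_mono) auto
  also have "\<dots> = (1 + R) ^ k * (Q - R) ^ n *
      (exp (real k * (- (R * (1 - cos \<phi>) / (1 + R)\<^sup>2))) * exp (real n * (R * (1 - cos \<phi>) * Q / (Q - R)\<^sup>2)))"
    by (simp only: power_mult_distrib exp_of_nat_mult mult_ac)
  also have "exp (real k * (- (R * (1 - cos \<phi>) / (1 + R)\<^sup>2))) * exp (real n * (R * (1 - cos \<phi>) * Q / (Q - R)\<^sup>2))
     = exp (R * (1 - cos \<phi>) * (real n * Q / (Q - R)\<^sup>2 - real k / (1 + R)\<^sup>2))"
    unfolding exp_add[symmetric] by (simp add: algebra_simps)
  finally show ?thesis .
qed

lemma has_derivative_divide_square:
  fixes f :: "real \<Rightarrow> real"
  assumes "(f has_real_derivative d) (at x)" "f x \<noteq> 0"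
  shows "((\<lambda>h. A / (f h)\<^sup>2) has_real_derivative - (2 * A * d / f x ^ 3)) (at x)"
  using assms by (auto intro!: derivative_eq_intros simp: field_simps power2_eq_square power3_eq_cube)

context tasep_parameters
begin

text \<open>
  At the radius \<open>\<theta>\<close> itself the bracket vanishes to leading order, since \<open>\<theta>\<close> is a double critical point. Decay
  comes from the slightly smaller radius, and its rate is the derivative in the radius, which is again the
  cubic coefficient.
\<close>
lemma curvature_derivative:
  fixes c :: real
  shows "((\<lambda>h. \<alpha> * odds / (odds - \<theta> * exp (- (h * c)))\<^sup>2 - (1 - \<Lambda> * \<alpha>) / (1 + \<theta> * exp (- (h * c)))\<^sup>2)
     has_real_derivative - (2 * c * cubic_coeff / \<theta>)) (at 0)"
    and "\<alpha> * odds / (odds - \<theta>)\<^sup>2 - (1 - \<Lambda> * \<alpha>) / (1 + \<theta>)\<^sup>2 = 0"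
proof -
  define u v where "u = odds - \<theta>" and "v = 1 + \<theta>"
  have uv: "u > 0" "v > 0" using theta_less_odds theta_pos by (auto simp: u_def v_def)
  have pq: "p - q * \<theta> = q * u" using q by (simp add: u_def odds_def field_simps)
  have a: "\<alpha> * odds = p * q * u\<^sup>2 / denom" unfolding alpha_eq pq odds_def using q by (simp add: power2_eq_square)
  have b: "1 - \<Lambda> * \<alpha> = p * q * v\<^sup>2 / denom" unfolding one_minus_lam_alpha v_def ..
  show "\<alpha> * odds / (odds - \<theta>)\<^sup>2 - (1 - \<Lambda> * \<alpha>) / (1 + \<theta>)\<^sup>2 = 0"
    unfolding a b u_def[symmetric] v_def[symmetric] using uv by simp
  have "((\<lambda>h. \<alpha> * odds / (odds - \<theta> * exp (- (h * c)))\<^sup>2 - (1 - \<Lambda> * \<alpha>) / (1 + \<theta> * exp (- (h * c)))\<^sup>2)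
     has_real_derivative - (2 * c * \<theta> * (\<alpha> * odds / u ^ 3 + (1 - \<Lambda> * \<alpha>) / v ^ 3))) (at 0)"
  proof -
    have "((\<lambda>h. odds - \<theta> * exp (- (h * c))) has_real_derivative \<theta> * c) (at 0)"
      "((\<lambda>h. 1 + \<theta> * exp (- (h * c))) has_real_derivative - (\<theta> * c)) (at 0)"
      by (auto intro!: derivative_eq_intros)
    note d = DERIV_diff[OF has_derivative_divide_square[OF this(1), of "\<alpha> * odds"]
        has_derivative_divide_square[OF this(2), of "1 - \<Lambda> * \<alpha>"]]
    show ?thesis
      by (rule DERIV_cong[OF d])
         (use uv in \<open>simp_all add: u_def v_def algebra_simps add_divide_distrib diff_divide_distrib\<close>)
  qed
  also have "\<alpha> * odds / u ^ 3 + (1 - \<Lambda> * \<alpha>) / v ^ 3 = p * q / denom * (1 / u + 1 / v)"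
  proof -
    have "p * q * s\<^sup>2 / denom / s ^ 3 = p * q / denom * (1 / s)" if "s > 0" for s
      using that by (simp add: power2_eq_square power3_eq_cube)
    thus ?thesis unfolding a b using uv by (simp only: distrib_left)
  qed
  also have "1 / u + 1 / v = (1 + odds) / (u * v)"
    using uv by (simp add: field_simps) (simp add: u_def v_def)
  also have "1 + odds = 1 / q" using q by (simp add: odds_def field_simps)
  also have "2 * c * \<theta> * (p * q / denom * (1 / q / (u * v))) = 2 * c * cubic_coeff / \<theta>"
    unfolding cubic_coeff_eq u_def[symmetric] v_def[symmetric] using q theta_pos by (simp add: power2_eq_square mult_ac)
  finally show "((\<lambda>h. \<alpha> * odds / (odds - \<theta> * exp (- (h * c)))\<^sup>2 - (1 - \<Lambda> * \<alpha>) / (1 + \<theta> * exp (- (h * c)))\<^sup>2)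
     has_real_derivative - (2 * c * cubic_coeff / \<theta>)) (at 0)" .
qed

end

context scaling
begin

definition radius :: "real \<Rightarrow> real \<Rightarrow> real" where
  "radius c \<epsilon> = \<theta> * exp (- (mesh \<epsilon> * c))"

lemma radius_tendsto: "(radius c \<longlongrightarrow> \<theta>) (at_right 0)"
proof -
  have "((\<lambda>\<epsilon>. \<theta> * exp (- (mesh \<epsilon> * c))) \<longlongrightarrow> \<theta> * exp (- (0 * c))) (at_right 0)"
    by (intro tendsto_intros mesh_tendsto_0)
  thus ?thesis by (simp add: radius_def[abs_def])
qed

lemma mesh_at: "filterlim mesh (at 0) (at_right 0)"
  unfolding filterlim_at using mesh_tendsto_0 eventually_at_right_less[of "0::real"]
  by (auto elim!: eventually_mono dest: mesh_pos)

text \<open>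
  The reduction of the radius (the term with \<open>T c\<close>) competes with the shift of the particle label (the term with \<open>X\<close>),
  which is of the same order. The sign is negative when \<open>T c + X > 0\<close>.
\<close>
lemma curvature_tendsto:
  "((\<lambda>\<epsilon>. (mesh \<epsilon>)\<^sup>2 * (real (label \<epsilon>) * odds / (odds - radius c \<epsilon>)\<^sup>2 - real (surplus \<epsilon>) / (1 + radius c \<epsilon>)\<^sup>2))
     \<longlongrightarrow> - (2 / \<theta> * (T * c + X))) (at_right 0)"
proof -
  define H where "H = (\<lambda>h. \<alpha> * odds / (odds - \<theta> * exp (- (h * c)))\<^sup>2 - (1 - \<Lambda> * \<alpha>) / (1 + \<theta> * exp (- (h * c)))\<^sup>2)"
  define Q where "Q = (\<lambda>\<epsilon>. \<Lambda> / (1 + radius c \<epsilon>)\<^sup>2 + odds / (odds - radius c \<epsilon>)\<^sup>2)"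
  define e1 where "e1 = (\<lambda>\<epsilon>. real (surplus \<epsilon>) - ((1 - \<Lambda> * \<alpha>) * time_scale \<epsilon> + \<Lambda> * label_shift \<epsilon>))"
  define e2 where "e2 = (\<lambda>\<epsilon>. real (label \<epsilon>) - (\<alpha> * time_scale \<epsilon> - label_shift \<epsilon>))"
  have nz: "1 + \<theta> \<noteq> 0" "odds - \<theta> \<noteq> 0" using theta_pos theta_less_odds by auto
  have "((\<lambda>h. H h / h) \<longlongrightarrow> - (2 * c * cubic_coeff / \<theta>)) (at 0)"
    using curvature_derivative(1)[of c, unfolded DERIV_def] curvature_derivative(2)
    by (simp add: H_def)
  hence "((\<lambda>\<epsilon>. H (mesh \<epsilon>) / mesh \<epsilon>) \<longlongrightarrow> - (2 * c * cubic_coeff / \<theta>)) (at_right 0)"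
    by (rule filterlim_compose[OF _ mesh_at])
  hence lim1: "((\<lambda>\<epsilon>. T / cubic_coeff * (H (mesh \<epsilon>) / mesh \<epsilon>)) \<longlongrightarrow> T / cubic_coeff * - (2 * c * cubic_coeff / \<theta>)) (at_right 0)"
    by (intro tendsto_intros)
  have "(Q \<longlongrightarrow> \<Lambda> / (1 + \<theta>)\<^sup>2 + odds / (odds - \<theta>)\<^sup>2) (at_right 0)"
    unfolding Q_def using nz by (intro tendsto_intros radius_tendsto) auto
  hence lim2: "((\<lambda>\<epsilon>. X / \<gamma>\<^sup>2 * Q \<epsilon>) \<longlongrightarrow> X / \<gamma>\<^sup>2 * (\<Lambda> / (1 + \<theta>)\<^sup>2 + odds / (odds - \<theta>)\<^sup>2)) (at_right 0)"
    by (intro tendsto_intros)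
  have e1: "\<forall>\<^sub>F \<epsilon> in at_right 0. \<bar>e1 \<epsilon>\<bar> \<le> real (a + b) + 2"
    and e2: "\<forall>\<^sub>F \<epsilon> in at_right 0. \<bar>e2 \<epsilon>\<bar> \<le> real (a + b) + 2"
    using rounding_errors unfolding e1_def e2_def by (auto elim: eventually_mono)
  have "((\<lambda>\<epsilon>. (mesh \<epsilon>)\<^sup>2 * odds / (odds - radius c \<epsilon>)\<^sup>2) \<longlongrightarrow> 0\<^sup>2 * odds / (odds - \<theta>)\<^sup>2) (at_right 0)"
    using nz by (intro tendsto_intros radius_tendsto mesh_tendsto_0) auto
  hence lim3: "((\<lambda>\<epsilon>. of_real (e2 \<epsilon>) * ((mesh \<epsilon>)\<^sup>2 * odds / (odds - radius c \<epsilon>)\<^sup>2)) \<longlongrightarrow> 0) (at_right 0)"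
    by (intro bounded_times_null[OF e2]) simp
  have "((\<lambda>\<epsilon>. (mesh \<epsilon>)\<^sup>2 / (1 + radius c \<epsilon>)\<^sup>2) \<longlongrightarrow> 0\<^sup>2 / (1 + \<theta>)\<^sup>2) (at_right 0)"
    using nz by (intro tendsto_intros radius_tendsto mesh_tendsto_0) auto
  hence lim4: "((\<lambda>\<epsilon>. of_real (e1 \<epsilon>) * ((mesh \<epsilon>)\<^sup>2 / (1 + radius c \<epsilon>)\<^sup>2)) \<longlongrightarrow> 0) (at_right 0)"
    by (intro bounded_times_null[OF e1]) simp
  have "((\<lambda>\<epsilon>. T / cubic_coeff * (H (mesh \<epsilon>) / mesh \<epsilon>) - X / \<gamma>\<^sup>2 * Q \<epsilon>
       + of_real (e2 \<epsilon>) * ((mesh \<epsilon>)\<^sup>2 * odds / (odds - radius c \<epsilon>)\<^sup>2) - of_real (e1 \<epsilon>) * ((mesh \<epsilon>)\<^sup>2 / (1 + radius c \<epsilon>)\<^sup>2))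
     \<longlongrightarrow> T / cubic_coeff * - (2 * c * cubic_coeff / \<theta>) - X / \<gamma>\<^sup>2 * (\<Lambda> / (1 + \<theta>)\<^sup>2 + odds / (odds - \<theta>)\<^sup>2) + 0 - 0) (at_right 0)"
    by (intro tendsto_add tendsto_diff lim1 lim2 lim3 lim4)
  also have "T / cubic_coeff * - (2 * c * cubic_coeff / \<theta>) - X / \<gamma>\<^sup>2 * (\<Lambda> / (1 + \<theta>)\<^sup>2 + odds / (odds - \<theta>)\<^sup>2) + 0 - 0 = - (2 / \<theta> * (T * c + X))"
  proof -
    have "\<Lambda> / (1 + \<theta>)\<^sup>2 + odds / (odds - \<theta>)\<^sup>2 = 2 * \<gamma>\<^sup>2 / \<theta>"
      using two_gam_square theta_pos by (simp add: field_simps)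
    thus ?thesis using cubic_coeff_pos gam_pos theta_pos
      by (simp only:) (simp add: algebra_simps add_divide_distrib)
  qed
  finally have lim: "((\<lambda>\<epsilon>. T / cubic_coeff * (H (mesh \<epsilon>) / mesh \<epsilon>) - X / \<gamma>\<^sup>2 * Q \<epsilon>
       + of_real (e2 \<epsilon>) * ((mesh \<epsilon>)\<^sup>2 * odds / (odds - radius c \<epsilon>)\<^sup>2) - of_real (e1 \<epsilon>) * ((mesh \<epsilon>)\<^sup>2 / (1 + radius c \<epsilon>)\<^sup>2))
     \<longlongrightarrow> - (2 / \<theta> * (T * c + X))) (at_right 0)" .
  show ?thesis
  proof (rule Lim_transform_eventually[OF lim])
    show "\<forall>\<^sub>F \<epsilon> in at_right 0. T / cubic_coeff * (H (mesh \<epsilon>) / mesh \<epsilon>) - X / \<gamma>\<^sup>2 * Q \<epsilon>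
       + of_real (e2 \<epsilon>) * ((mesh \<epsilon>)\<^sup>2 * odds / (odds - radius c \<epsilon>)\<^sup>2) - of_real (e1 \<epsilon>) * ((mesh \<epsilon>)\<^sup>2 / (1 + radius c \<epsilon>)\<^sup>2)
      = (mesh \<epsilon>)\<^sup>2 * (real (label \<epsilon>) * odds / (odds - radius c \<epsilon>)\<^sup>2 - real (surplus \<epsilon>) / (1 + radius c \<epsilon>)\<^sup>2)"
      using eventually_at_right_less[of 0]
    proof eventually_elim
      case (elim \<epsilon>)
      define x y where "x = 1 / (odds - radius c \<epsilon>)\<^sup>2" and "y = 1 / (1 + radius c \<epsilon>)\<^sup>2"
      have time_scale': "(mesh \<epsilon>)\<^sup>2 * time_scale \<epsilon> = T / cubic_coeff / mesh \<epsilon>"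
        unfolding time_scale_mesh[OF elim] using mesh_pos[OF elim] by (simp add: power2_eq_square power3_eq_cube)
      have label_shift': "(mesh \<epsilon>)\<^sup>2 * label_shift \<epsilon> = X / \<gamma>\<^sup>2"
        unfolding label_shift_mesh[OF elim] using mesh_pos[OF elim] by simp
      have H': "H (mesh \<epsilon>) = \<alpha> * odds * x - (1 - \<Lambda> * \<alpha>) * y" and Q': "Q \<epsilon> = \<Lambda> * y + odds * x"
        by (simp_all add: H_def Q_def x_def y_def radius_def)
      have "(mesh \<epsilon>)\<^sup>2 * (real (label \<epsilon>) * odds * x - real (surplus \<epsilon>) * y)
         = ((mesh \<epsilon>)\<^sup>2 * time_scale \<epsilon>) * H (mesh \<epsilon>) - ((mesh \<epsilon>)\<^sup>2 * label_shift \<epsilon>) * Q \<epsilon>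
           + e2 \<epsilon> * ((mesh \<epsilon>)\<^sup>2 * odds * x) - e1 \<epsilon> * ((mesh \<epsilon>)\<^sup>2 * y)"
        unfolding H' Q' e1_def e2_def by (simp add: algebra_simps)
      thus ?case unfolding time_scale' label_shift' by (simp add: x_def y_def)
    qed
  qed
qed

text \<open>
  Relative to its value at angle \<open>0\<close>, which converges, the profile is bounded by \<open>exp (R (1 - cos \<phi>) B)\<close> with \<open>B\<close> of order
  \<open>- 1 / \<eta>^2\<close>, and \<open>1 - cos \<phi>\<close> is at least a multiple of \<open>\<eta>^2 \<tau>^2\<close> for all angles up to \<open>\<pi>\<close>.
\<close>
lemma profile_gaussian_bound:
  assumes c: "0 < c" and cX: "0 < T * c + X"
  obtains C k where "k > 0"
    "\<forall>\<^sub>F \<epsilon> in at_right 0. \<forall>\<tau>. \<bar>mesh \<epsilon> * \<tau>\<bar> \<le> pi \<longrightarrow> norm (profile \<epsilon> (Complex c \<tau>)) \<le> C * exp (- k * \<tau>\<^sup>2)"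
proof
  define \<kappa> where "\<kappa> = (T * c + X) / \<theta>"
  have \<kappa>: "\<kappa> > 0" using cX theta_pos by (simp add: \<kappa>_def)
  define C where "C = norm (exp (of_real T * of_real c ^ 3 / 3 + of_real X * of_real c ^ 2 :: complex)) + 1"
  show "\<theta> * \<kappa> / 16 > 0" using \<kappa> theta_pos by simp
  have "\<forall>\<^sub>F \<epsilon> in at_right 0. norm (profile \<epsilon> (of_real c)) < C"
    using tendsto_norm[OF profile_tendsto[of "of_real c"]] unfolding C_def
    by (rule order_tendstoD) simp
  moreover have "\<forall>\<^sub>F \<epsilon> in at_right 0. (mesh \<epsilon>)\<^sup>2 * (real (label \<epsilon>) * odds / (odds - radius c \<epsilon>)\<^sup>2 - real (surplus \<epsilon>) / (1 + radius c \<epsilon>)\<^sup>2) < - \<kappa>"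
  proof (rule order_tendstoD(2)[OF curvature_tendsto[of c]])
    have "2 / \<theta> * (T * c + X) = 2 * \<kappa>" by (simp add: \<kappa>_def)
    thus "- (2 / \<theta> * (T * c + X)) < - \<kappa>" using \<kappa> by linarith
  qed
  moreover have "\<forall>\<^sub>F \<epsilon> in at_right 0. \<theta> / 2 < radius c \<epsilon>"
    using radius_tendsto by (rule order_tendstoD) (use theta_pos in simp)
  ultimately show "\<forall>\<^sub>F \<epsilon> in at_right 0. \<forall>\<tau>. \<bar>mesh \<epsilon> * \<tau>\<bar> \<le> pi \<longrightarrow>
      norm (profile \<epsilon> (Complex c \<tau>)) \<le> C * exp (- (\<theta> * \<kappa> / 16) * \<tau>\<^sup>2)"
    using eventually_at_right_less[of 0]
  proof eventually_elim
    case (elim \<epsilon>)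
    show ?case
    proof (intro allI impI)
      fix \<tau> assume \<tau>: "\<bar>mesh \<epsilon> * \<tau>\<bar> \<le> pi"
      define R where "R = radius c \<epsilon>"
      define \<phi> where "\<phi> = - (mesh \<epsilon> * \<tau>)"
      define n k where "n = label \<epsilon>" and "k = surplus \<epsilon>"
      define B where "B = real n * odds / (odds - R)\<^sup>2 - real k / (1 + R)\<^sup>2"
      have mesh: "mesh \<epsilon> > 0" by (rule mesh_pos[OF elim(4)])
      have R0: "R > 0" using elim(3) theta_pos by (simp add: R_def)
      have "R \<le> \<theta> * 1" unfolding R_def radius_def using mesh c theta_pos by (intro mult_left_mono) auto
      hence RP: "R < odds" using theta_less_odds by simp
      have expw: "of_real \<theta> * exp (- (of_real (mesh \<epsilon>) * Complex c \<tau>)) = of_real R * cis \<phi>"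
      proof -
        have eq: "- (of_real (mesh \<epsilon>) * Complex c \<tau>) = of_real (- (mesh \<epsilon> * c)) + \<i> * of_real \<phi>"
          by (simp add: complex_eq_iff \<phi>_def)
        show ?thesis unfolding eq exp_add exp_of_real cis_conv_exp by (simp add: R_def radius_def)
      qed
      have expc: "of_real \<theta> * exp (- (of_real (mesh \<epsilon>) * of_real c)) = (of_real R :: complex)"
        by (simp add: R_def radius_def flip: exp_of_real)
      have drift: "norm (exp (of_real (drift \<epsilon>) * (of_real (mesh \<epsilon>) * Complex c \<tau>))) =
          norm (exp (of_real (drift \<epsilon>) * (of_real (mesh \<epsilon>) * of_real c :: complex)))"
        by (simp add: norm_exp_eq_Re)
      define E where "E = norm (exp (of_real (drift \<epsilon>) * (of_real (mesh \<epsilon>) * of_real c :: complex)))"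
      define den where "den = norm (of_real (1 + \<theta>) :: complex) ^ k * norm (of_real (odds - \<theta>) :: complex) ^ n"
      have den: "den > 0" unfolding den_def using nonzero_of_real by (intro mult_pos_pos zero_less_power) (simp_all only: zero_less_norm_iff not_False_eq_True)
      have profile1: "norm (profile \<epsilon> (Complex c \<tau>)) = norm (1 + of_real R * cis \<phi>) ^ k * norm (of_real odds - of_real R * cis \<phi>) ^ n / den * E"
        unfolding profile_def expw norm_mult norm_power norm_divide drift
        by (simp only: power_divide times_divide_times_eq den_def E_def n_def k_def norm_mult)
      have profile2: "norm (profile \<epsilon> (of_real c)) = (1 + R) ^ k * (odds - R) ^ n / den * E"
      proof -
        have "norm (1 + of_real R :: complex) = 1 + R" "norm (of_real odds - of_real R :: complex) = odds - R"
          using R0 RP norm_of_real[of "1 + R", where 'a = complex] norm_of_real[of "odds - R", where 'a = complex] by simp_all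
        thus ?thesis
          unfolding profile_def expc norm_mult norm_power norm_divide
          by (simp only: power_divide times_divide_times_eq den_def E_def n_def k_def norm_mult)
      qed
      have "norm (profile \<epsilon> (Complex c \<tau>)) \<le> (1 + R) ^ k * (odds - R) ^ n * exp (R * (1 - cos \<phi>) * B) / den * E"
        unfolding profile1 B_def using norm_product_on_circle[OF R0 RP] den
        by (intro mult_right_mono divide_right_mono) (auto simp: E_def)
      also have "\<dots> = norm (profile \<epsilon> (of_real c)) * exp (R * (1 - cos \<phi>) * B)"
        unfolding profile2 by simp
      also have "\<dots> \<le> C * exp (- (\<theta> * \<kappa> / 16) * \<tau>\<^sup>2)"
      proof (intro mult_mono)
        have angle: "(\<theta> / 2) * (\<phi>\<^sup>2 / 8) \<le> R * (1 - cos \<phi>)"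
          using elim(3) one_minus_cos_lower_bound[of \<phi>] \<tau> theta_pos R0
          by (intro mult_mono) (auto simp: R_def \<phi>_def)
        have "B < - \<kappa> / (mesh \<epsilon>)\<^sup>2"
          using elim(2) mesh unfolding B_def n_def k_def R_def by (simp add: field_simps)
        hence "\<kappa> / (mesh \<epsilon>)\<^sup>2 \<le> - B" by simp
        from mult_mono[OF angle this]
        have "(\<theta> / 2) * (\<phi>\<^sup>2 / 8) * (\<kappa> / (mesh \<epsilon>)\<^sup>2) \<le> R * (1 - cos \<phi>) * (- B)"
          using \<kappa> R0 by simp
        moreover have "(\<theta> / 2) * (\<phi>\<^sup>2 / 8) * (\<kappa> / (mesh \<epsilon>)\<^sup>2) = \<theta> * \<kappa> / 16 * \<tau>\<^sup>2"
          using mesh by (simp add: \<phi>_def power_mult_distrib)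
        ultimately have "R * (1 - cos \<phi>) * B \<le> - (\<theta> * \<kappa> / 16) * \<tau>\<^sup>2"
          unfolding mult_minus_right mult_minus_left by linarith
        thus "exp (R * (1 - cos \<phi>) * B) \<le> exp (- (\<theta> * \<kappa> / 16) * \<tau>\<^sup>2)"
          by (simp only: exp_le_cancel_iff)
        show "norm (profile \<epsilon> (of_real c)) \<le> C" using elim(1) by simp
        show "0 \<le> C" by (simp add: C_def)
      qed auto
      finally show "norm (profile \<epsilon> (Complex c \<tau>)) \<le> C * exp (- (\<theta> * \<kappa> / 16) * \<tau>\<^sup>2)" .
    qed
  qed
qed

end

section \<open>Dominated convergence, uniformly in the tilt\<close>

lemma dominated_convergence_at_right_0:
  fixes s :: "real \<Rightarrow> 'a \<Rightarrow> 'b::{banach, second_countable_topology}"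
  assumes "f \<in> borel_measurable M" "\<And>t. s t \<in> borel_measurable M" "integrable M w"
    and lim: "\<And>x. ((\<lambda>t. s t x) \<longlongrightarrow> f x) (at_right 0)"
    and bound: "\<forall>\<^sub>F t in at_right 0. \<forall>x. norm (s t x) \<le> w x"
  shows "((\<lambda>t. integral\<^sup>L M (s t)) \<longlongrightarrow> integral\<^sup>L M f) (at_right 0)"
  unfolding filterlim_at_right_to_top[of "\<lambda>t. integral\<^sup>L M (s t)"]
proof (rule integral_dominated_convergence_at_top[where w = w])
  show "\<forall>\<^sub>F t in at_top. AE x in M. norm (s (inverse t) x) \<le> w x"
    using bound unfolding eventually_at_right_to_top by (auto elim: eventually_mono)
  show "AE x in M. ((\<lambda>t. s (inverse t) x) \<longlongrightarrow> f x) at_top"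
    using lim unfolding filterlim_at_right_to_top by simp
qed (use assms in auto)

lemma norm_exp_minus_one_le:
  fixes z :: complex
  shows "norm (exp z - 1) \<le> norm z * exp (norm z)"
proof -
  have "norm (exp z - exp 0) \<le> exp (norm z) * norm (z - 0)"
  proof (rule field_differentiable_bound[where S = "closed_segment 0 z" and f' = exp])
    fix v assume "v \<in> closed_segment 0 z"
    hence "norm v \<le> norm z" using segment_bound(1)[of v 0 z] by simp
    thus "norm (exp v) \<le> exp (norm z)" using norm_exp[of v] by (meson exp_le_cancel_iff order_trans)
  qed (auto intro: has_field_derivative_at_within)
  thus ?thesis by (simp add: mult.commute)
qed

text \<open>
  On the support of \<open>B \<epsilon>\<close> the quantity \<open>h \<epsilon> * \<tau>\<close> is bounded, so the rounding error \<open>e\<close> changes the integrand by at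
  most \<open>K * h \<epsilon> * (c + |\<tau>|)\<close> relatively, and the tilt has modulus at most \<open>exp (M * c)\<close>. Hence a single function \<open>S\<close>, free of
  \<open>\<zeta>\<close> and \<open>u\<close>, bounds the difference of the integrands, and dominated convergence for \<open>S\<close> gives the
  uniform limit.
\<close>
lemma uniform_limit_tilted_integrals:
  fixes B :: "real \<Rightarrow> real \<Rightarrow> complex" and A :: "real \<Rightarrow> complex"
    and h :: "real \<Rightarrow> real" and e :: "real \<Rightarrow> real \<Rightarrow> real \<Rightarrow> real" and c C k M :: real
  assumes [measurable]: "\<And>\<epsilon>. B \<epsilon> \<in> borel_measurable borel" "A \<in> borel_measurable borel"
    and lim: "\<And>\<tau>. ((\<lambda>\<epsilon>. B \<epsilon> \<tau>) \<longlongrightarrow> A \<tau>) (at_right 0)"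
    and k: "k > 0"
    and bound: "\<forall>\<^sub>F \<epsilon> in at_right 0. \<forall>\<tau>. norm (B \<epsilon> \<tau>) \<le> C * exp (- k * \<tau>\<^sup>2)"
    and h: "(h \<longlongrightarrow> 0) (at_right 0)" "\<forall>\<^sub>F \<epsilon> in at_right 0. 0 < h \<epsilon>"
    and supp: "\<forall>\<^sub>F \<epsilon> in at_right 0. \<forall>\<tau>. B \<epsilon> \<tau> \<noteq> 0 \<longrightarrow> \<bar>h \<epsilon> * \<tau>\<bar> \<le> pi"
    and e: "\<And>\<epsilon> \<zeta> u. \<bar>e \<epsilon> \<zeta> u\<bar> \<le> 1"
    and c: "c > 0"
  shows "uniform_limit {(\<zeta>, u). \<bar>\<zeta> - u\<bar> \<le> M}
     (\<lambda>\<epsilon> (\<zeta>, u). \<integral>\<tau>. B \<epsilon> \<tau> * exp (of_real (u - \<zeta> + e \<epsilon> \<zeta> u * h \<epsilon>) * Complex c \<tau>) \<partial>lborel)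
     (\<lambda>(\<zeta>, u). \<integral>\<tau>. A \<tau> * exp (of_real (u - \<zeta>) * Complex c \<tau>) \<partial>lborel) (at_right 0)"
proof (rule uniform_limitI)
  fix d :: real assume d: "d > 0"
  define K where "K = exp (c + pi)"
  define L where "L = 2 * C + K * C * exp (c + 1 / (2 * k))"
  define S where "S = (\<lambda>\<epsilon> \<tau>. norm (B \<epsilon> \<tau> - A \<tau>) + K * (h \<epsilon> * norm (B \<epsilon> \<tau>) * (c + \<bar>\<tau>\<bar>)))"
  have [measurable]: "(\<lambda>\<tau>. Complex c \<tau>) \<in> borel_measurable borel"
    unfolding Complex_eq by measurable
  have [measurable]: "S \<epsilon> \<in> borel_measurable borel" for \<epsilon> unfolding S_def by measurable
  have A: "norm (A \<tau>) \<le> C * exp (- k * \<tau>\<^sup>2)" for \<tau>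
    by (rule tendsto_upperbound[OF tendsto_norm[OF lim]])
       (use bound in \<open>auto elim: eventually_mono\<close>)
  have C: "C \<ge> 0" using order_trans[OF norm_ge_zero A[of 0]] by simp
  have h1: "\<forall>\<^sub>F \<epsilon> in at_right 0. h \<epsilon> < 1" using order_tendstoD(2)[OF h(1), of 1] by simp
  have int_k: "integrable lborel (\<lambda>\<tau>. C * exp (- k * \<tau>\<^sup>2))"
    by (intro integrable_mult_right integrable_gaussian k)
  have int_L: "integrable lborel (\<lambda>\<tau>. L * exp (- (k / 2) * \<tau>\<^sup>2))"
    using k by (intro integrable_mult_right integrable_gaussian) auto
  have S_bound: "norm (S \<epsilon> \<tau>) \<le> L * exp (- (k / 2) * \<tau>\<^sup>2)"
    if B: "\<forall>\<tau>. norm (B \<epsilon> \<tau>) \<le> C * exp (- k * \<tau>\<^sup>2)" and h: "0 < h \<epsilon>" "h \<epsilon> < 1" for \<epsilon> \<tau>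
  proof -
    have "norm (B \<epsilon> \<tau> - A \<tau>) \<le> norm (B \<epsilon> \<tau>) + norm (A \<tau>)" by (rule norm_triangle_ineq4)
    also have "\<dots> \<le> 2 * C * exp (- k * \<tau>\<^sup>2)" using A[of \<tau>] B[rule_format, of \<tau>] by simp
    also have "\<dots> \<le> 2 * C * exp (- (k / 2) * \<tau>\<^sup>2)"
      using C k by (intro mult_left_mono) auto
    finally have 1: "norm (B \<epsilon> \<tau> - A \<tau>) \<le> 2 * C * exp (- (k / 2) * \<tau>\<^sup>2)" .
    \<comment> \<open>The linear factor \<open>c + |\<tau>|\<close> is absorbed at the price of half of the Gaussian exponent.\<close>
    have "0 \<le> k / 2 * (\<bar>\<tau>\<bar> - 1 / k)\<^sup>2" using k by simp
    also have "\<dots> = k / 2 * \<tau>\<^sup>2 - \<bar>\<tau>\<bar> + 1 / (2 * k)"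
      using k by (simp add: power2_diff field_simps power2_eq_square)
    finally have "\<bar>\<tau>\<bar> \<le> k / 2 * \<tau>\<^sup>2 + 1 / (2 * k)" by simp
    hence "c + \<bar>\<tau>\<bar> \<le> c + 1 / (2 * k) + k / 2 * \<tau>\<^sup>2" by simp
    also have "\<dots> \<le> exp (c + 1 / (2 * k) + k / 2 * \<tau>\<^sup>2)"
      using exp_ge_add_one_self[of "c + 1 / (2 * k) + k / 2 * \<tau>\<^sup>2"] by linarith
    finally have 2: "c + \<bar>\<tau>\<bar> \<le> exp (c + 1 / (2 * k) + k / 2 * \<tau>\<^sup>2)" .
    have "h \<epsilon> * norm (B \<epsilon> \<tau>) * (c + \<bar>\<tau>\<bar>) \<le> 1 * (C * exp (- k * \<tau>\<^sup>2)) * exp (c + 1 / (2 * k) + k / 2 * \<tau>\<^sup>2)"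
      using h B c C 2 by (intro mult_mono) auto
    also have "\<dots> = C * exp (c + 1 / (2 * k)) * exp (- (k / 2) * \<tau>\<^sup>2)"
      by (simp add: mult.assoc exp_add[symmetric] del: exp_add)
    finally have "K * (h \<epsilon> * norm (B \<epsilon> \<tau>) * (c + \<bar>\<tau>\<bar>)) \<le> K * (C * exp (c + 1 / (2 * k)) * exp (- (k / 2) * \<tau>\<^sup>2))"
      by (intro mult_left_mono) (auto simp: K_def)
    with 1 have "S \<epsilon> \<tau> \<le> L * exp (- (k / 2) * \<tau>\<^sup>2)" unfolding S_def L_def by (simp add: algebra_simps)
    moreover have "0 \<le> S \<epsilon> \<tau>" unfolding S_def K_def using h c by simp
    ultimately show ?thesis by simp
  qed
  have "((\<lambda>\<epsilon>. integral\<^sup>L lborel (S \<epsilon>)) \<longlongrightarrow> integral\<^sup>L lborel (\<lambda>\<tau>::real. 0)) (at_right 0)"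
  proof (rule dominated_convergence_at_right_0[OF _ _ int_L])
    fix \<tau>
    have "((\<lambda>\<epsilon>. norm (B \<epsilon> \<tau> - A \<tau>) + K * (h \<epsilon> * norm (B \<epsilon> \<tau>) * (c + \<bar>\<tau>\<bar>))) \<longlongrightarrow>
        norm (A \<tau> - A \<tau>) + K * (0 * norm (A \<tau>) * (c + \<bar>\<tau>\<bar>))) (at_right 0)"
      by (intro tendsto_intros lim h)
    thus "((\<lambda>\<epsilon>. S \<epsilon> \<tau>) \<longlongrightarrow> 0) (at_right 0)" by (simp add: S_def)
    show "\<forall>\<^sub>F \<epsilon> in at_right 0. \<forall>\<tau>. norm (S \<epsilon> \<tau>) \<le> L * exp (- (k / 2) * \<tau>\<^sup>2)"
      using bound h(2) h1 by eventually_elim (use S_bound in blast)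
  qed simp_all
  hence "\<forall>\<^sub>F \<epsilon> in at_right 0. integral\<^sup>L lborel (S \<epsilon>) < d / exp (M * c)"
    by (rule order_tendstoD) (use d in simp)
  thus "\<forall>\<^sub>F \<epsilon> in at_right 0. \<forall>x\<in>{(\<zeta>, u). \<bar>\<zeta> - u\<bar> \<le> M}. dist
     (case x of (\<zeta>, u) \<Rightarrow> \<integral>\<tau>. B \<epsilon> \<tau> * exp (of_real (u - \<zeta> + e \<epsilon> \<zeta> u * h \<epsilon>) * Complex c \<tau>) \<partial>lborel)
     (case x of (\<zeta>, u) \<Rightarrow> \<integral>\<tau>. A \<tau> * exp (of_real (u - \<zeta>) * Complex c \<tau>) \<partial>lborel) < d"
    using bound h(2) h1 supp
  proof eventually_elim
    case (elim \<epsilon>)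
    have int_S: "integrable lborel (S \<epsilon>)"
      by (rule Bochner_Integration.integrable_bound[OF int_L])
         (use S_bound[OF elim(2,3,4)] in \<open>auto intro!: AE_I2 order_trans[OF _ abs_ge_self]\<close>)
    have "dist (\<integral>\<tau>. B \<epsilon> \<tau> * exp (of_real (u - \<zeta> + e \<epsilon> \<zeta> u * h \<epsilon>) * Complex c \<tau>) \<partial>lborel)
       (\<integral>\<tau>. A \<tau> * exp (of_real (u - \<zeta>) * Complex c \<tau>) \<partial>lborel) < d" if M: "\<bar>\<zeta> - u\<bar> \<le> M" for \<zeta> u
    proof -
      have tilt: "norm (exp (of_real v * Complex c \<tau>)) = exp (v * c)" for v \<tau>
        by (simp add: norm_exp_eq_Re)
      have int_tilt: "integrable lborel (\<lambda>\<tau>. Z \<tau> * exp (of_real v * Complex c \<tau>))"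
        if [measurable]: "Z \<in> borel_measurable borel" and Z: "\<And>\<tau>. norm (Z \<tau>) \<le> C * exp (- k * \<tau>\<^sup>2)" for Z v
      proof (rule Bochner_Integration.integrable_bound)
        show "integrable lborel (\<lambda>\<tau>. C * exp (- k * \<tau>\<^sup>2) * exp (v * c))"
          by (intro integrable_mult_left int_k)
        show "AE \<tau> in lborel. norm (Z \<tau> * exp (of_real v * Complex c \<tau>)) \<le> norm (C * exp (- k * \<tau>\<^sup>2) * exp (v * c))"
        proof (rule AE_I2)
          fix \<tau>
          have "norm (Z \<tau> * exp (of_real v * Complex c \<tau>)) = norm (Z \<tau>) * exp (v * c)"
            by (simp only: norm_mult tilt)
          also have "\<dots> \<le> C * exp (- k * \<tau>\<^sup>2) * exp (v * c)" by (intro mult_right_mono Z) auto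
          also have "\<dots> \<le> norm (C * exp (- k * \<tau>\<^sup>2) * exp (v * c))" by simp
          finally show "norm (Z \<tau> * exp (of_real v * Complex c \<tau>)) \<le> norm (C * exp (- k * \<tau>\<^sup>2) * exp (v * c))" .
        qed
      qed measurable
      have int1: "integrable lborel (\<lambda>\<tau>. B \<epsilon> \<tau> * exp (of_real (u - \<zeta> + e \<epsilon> \<zeta> u * h \<epsilon>) * Complex c \<tau>))"
        using elim(2) by (intro int_tilt) auto
      have int2: "integrable lborel (\<lambda>\<tau>. A \<tau> * exp (of_real (u - \<zeta>) * Complex c \<tau>))"
        using A by (intro int_tilt) auto
      have ptw: "norm (B \<epsilon> \<tau> * exp (of_real (u - \<zeta> + e \<epsilon> \<zeta> u * h \<epsilon>) * Complex c \<tau>) - A \<tau> * exp (of_real (u - \<zeta>) * Complex c \<tau>))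
          \<le> exp (M * c) * S \<epsilon> \<tau>" for \<tau>
      proof -
        define w where "w = Complex c \<tau>"
        define z where "z = of_real (e \<epsilon> \<zeta> u * h \<epsilon>) * w"
        have "norm w \<le> c + \<bar>\<tau>\<bar>" unfolding w_def using cmod_le[of "Complex c \<tau>"] c by simp
        hence "\<bar>e \<epsilon> \<zeta> u\<bar> * (h \<epsilon> * norm w) \<le> 1 * (h \<epsilon> * (c + \<bar>\<tau>\<bar>))"
          using e elim(3) c by (intro mult_mono mult_left_mono) auto
        hence z: "norm z \<le> h \<epsilon> * (c + \<bar>\<tau>\<bar>)"
          using elim(3) by (simp add: z_def norm_mult abs_mult mult.assoc)
        have "norm (B \<epsilon> \<tau>) * norm (exp z - 1) \<le> K * (h \<epsilon> * norm (B \<epsilon> \<tau>) * (c + \<bar>\<tau>\<bar>))"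
        proof (cases "B \<epsilon> \<tau> = 0")
          case False
          hence "\<bar>h \<epsilon> * \<tau>\<bar> \<le> pi" using elim(5) by blast
          moreover have "h \<epsilon> * c \<le> 1 * c" using elim(4) c by (intro mult_right_mono) auto
          ultimately have zK: "norm z \<le> c + pi"
            using z elim(3) by (simp add: algebra_simps abs_mult)
          have "norm (exp z - 1) \<le> norm z * exp (norm z)" by (rule norm_exp_minus_one_le)
          also have "\<dots> \<le> h \<epsilon> * (c + \<bar>\<tau>\<bar>) * K"
            unfolding K_def using z zK elim(3) c by (intro mult_mono) auto
          finally have "norm (B \<epsilon> \<tau>) * norm (exp z - 1) \<le> norm (B \<epsilon> \<tau>) * (h \<epsilon> * (c + \<bar>\<tau>\<bar>) * K)"
            by (intro mult_left_mono) auto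
          thus ?thesis by (simp only: mult_ac)
        qed simp
        hence S: "norm (B \<epsilon> \<tau> - A \<tau>) + norm (B \<epsilon> \<tau>) * norm (exp z - 1) \<le> S \<epsilon> \<tau>"
          unfolding S_def by simp
        have split: "of_real (u - \<zeta> + e \<epsilon> \<zeta> u * h \<epsilon>) * w = of_real (u - \<zeta>) * w + z"
          by (simp add: z_def algebra_simps)
        have "B \<epsilon> \<tau> * exp (of_real (u - \<zeta> + e \<epsilon> \<zeta> u * h \<epsilon>) * w) - A \<tau> * exp (of_real (u - \<zeta>) * w)
           = exp (of_real (u - \<zeta>) * w) * ((B \<epsilon> \<tau> - A \<tau>) + B \<epsilon> \<tau> * (exp z - 1))"
          unfolding split exp_add by (simp add: algebra_simps)
        also have "norm \<dots> \<le> exp ((u - \<zeta>) * c) * (norm (B \<epsilon> \<tau> - A \<tau>) + norm (B \<epsilon> \<tau>) * norm (exp z - 1))"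
          unfolding norm_mult tilt w_def
          by (intro mult_left_mono order_trans[OF norm_triangle_ineq]) (auto simp: norm_mult)
        also have "\<dots> \<le> exp (M * c) * S \<epsilon> \<tau>"
          using S M c by (intro mult_mono) auto
        finally show ?thesis unfolding w_def .
      qed
      have "norm (\<integral>\<tau>. B \<epsilon> \<tau> * exp (of_real (u - \<zeta> + e \<epsilon> \<zeta> u * h \<epsilon>) * Complex c \<tau>) - A \<tau> * exp (of_real (u - \<zeta>) * Complex c \<tau>) \<partial>lborel)
         \<le> (\<integral>\<tau>. exp (M * c) * S \<epsilon> \<tau> \<partial>lborel)"
        by (intro Bochner_Integration.integral_norm_bound_integral Bochner_Integration.integrable_diff int1 int2 integrable_mult_right int_S ptw)
      also have "\<dots> < d" using elim(1) by (simp add: field_simps)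
      finally show ?thesis
        unfolding dist_norm Bochner_Integration.integral_diff[OF int1 int2] .
    qed
    thus ?case by auto
  qed
qed

context scaling
begin

definition displacement :: "real \<Rightarrow> real \<Rightarrow> real \<Rightarrow> int" where
  "displacement \<epsilon> \<zeta> u = \<lfloor>\<beta> * time_scale \<epsilon> + label_shift \<epsilon> / \<rho> + u / mesh \<epsilon>\<rfloor> - \<lfloor>\<zeta> / mesh \<epsilon>\<rfloor>"

definition rounding :: "real \<Rightarrow> real \<Rightarrow> real \<Rightarrow> real" where
  "rounding \<epsilon> \<zeta> u = of_int (displacement \<epsilon> \<zeta> u) - (\<beta> * time_scale \<epsilon> + label_shift \<epsilon> / \<rho> + (u - \<zeta>) / mesh \<epsilon>)"

text \<open>A difference of two floors differs from the difference of the arguments by at most \<open>1\<close>.\<close>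
lemma rounding_le_1: "\<bar>rounding \<epsilon> \<zeta> u\<bar> \<le> 1"
  unfolding rounding_def displacement_def diff_divide_distrib of_int_diff by linarith

lemma jump_integrand_eq_profile:
  fixes \<epsilon> c \<tau> \<zeta> u :: real
  assumes mesh: "mesh \<epsilon> > 0"
  defines "w \<equiv> of_real (radius c \<epsilon>) * cis (- (mesh \<epsilon> * \<tau>))"
  shows "jump_integrand (surplus \<epsilon>) (label \<epsilon>) (displacement \<epsilon> \<zeta> u + int (label \<epsilon>)) w * w =
     profile \<epsilon> (Complex c \<tau>) * exp (of_real (u - \<zeta> + rounding \<epsilon> \<zeta> u * mesh \<epsilon>) * Complex c \<tau>)"
proof -
  define \<omega> where "\<omega> = of_real (mesh \<epsilon>) * Complex c \<tau>"
  define m where "m = displacement \<epsilon> \<zeta> u + int (label \<epsilon>)"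
  have \<omega>: "- \<omega> = of_real (- (mesh \<epsilon> * c)) + \<i> * of_real (- (mesh \<epsilon> * \<tau>))"
    by (simp add: complex_eq_iff \<omega>_def)
  have w: "w = of_real \<theta> * exp (- \<omega>)"
    unfolding \<omega> exp_add exp_of_real cis_conv_exp w_def by (simp add: radius_def)
  have w0: "w \<noteq> 0" unfolding w using theta_pos by simp
  have "of_real \<theta> / w = exp \<omega>" unfolding w using theta_pos by (simp add: exp_minus field_simps)
  hence pow: "(of_real \<theta> / w) powi m = exp (of_int m * \<omega>)" by (simp add: exp_power_int)
  have "of_int m * mesh \<epsilon> = drift \<epsilon> * mesh \<epsilon> + (u - \<zeta> + rounding \<epsilon> \<zeta> u * mesh \<epsilon>)"
    using mesh unfolding m_def drift_def rounding_def by (simp add: field_simps)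
  hence "of_int m * \<omega> = of_real (drift \<epsilon>) * \<omega> + of_real (u - \<zeta> + rounding \<epsilon> \<zeta> u * mesh \<epsilon>) * Complex c \<tau>"
    unfolding \<omega>_def
    by (metis (no_types, lifting) distrib_right mult.assoc of_real_add of_real_mult of_real_of_int_eq)
  hence pow': "(of_real \<theta> / w) powi m = exp (of_real (drift \<epsilon>) * \<omega>) * exp (of_real (u - \<zeta> + rounding \<epsilon> \<zeta> u * mesh \<epsilon>) * Complex c \<tau>)"
    unfolding pow by (simp only: exp_add)
  have jump: "jump_integrand (surplus \<epsilon>) (label \<epsilon>) m w * w = ((1 + w) / of_real (1 + \<theta>)) ^ surplus \<epsilon> *
      ((of_real odds - w) / of_real (odds - \<theta>)) ^ label \<epsilon> * (of_real \<theta> / w) powi m"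
    unfolding jump_integrand_def using w0 by simp
  show ?thesis
    unfolding m_def[symmetric] jump
    unfolding pow' profile_def \<omega>_def[symmetric] w[symmetric] by (simp only: mult.assoc)
qed

lemma kernel_S_eps_eq_integral:
  assumes \<epsilon>: "0 < \<epsilon>" and count: "parallel_count (label \<epsilon>) \<le> steps \<epsilon>" and r: "0 < r" "r < 1"
  shows "kernel_S_eps p \<rho> a b r T X \<epsilon> \<zeta> u = 1 / (2 * of_real pi) *
    (\<integral>\<tau>. (indicator {- (pi / mesh \<epsilon>)..pi / mesh \<epsilon>} \<tau> *\<^sub>R profile \<epsilon> (Complex c \<tau>))
       * exp (of_real (u - \<zeta> + rounding \<epsilon> \<zeta> u * mesh \<epsilon>) * Complex c \<tau>) \<partial>lborel)"
proof -
  define R where "R = radius c \<epsilon>"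
  define x y where "x = \<lfloor>\<beta> * time_scale \<epsilon> + label_shift \<epsilon> / \<rho> + u / mesh \<epsilon>\<rfloor>" and "y = \<lfloor>\<zeta> / mesh \<epsilon>\<rfloor>"
  define J where "J = jump_integrand (surplus \<epsilon>) (label \<epsilon>) (x - y + int (label \<epsilon>))"
  have mesh: "mesh \<epsilon> > 0" by (rule mesh_pos[OF \<epsilon>])
  have R: "R > 0" using theta_pos by (simp add: R_def radius_def)
  have scale: "\<gamma> * \<sigma> * \<epsilon> powr (-1/2) = 1 / mesh \<epsilon>"
    using \<epsilon> by (simp add: mesh_def powr_minus_divide powr_half_sqrt)
  have n: "\<alpha> * \<epsilon> powr (-3/2) * T - \<sigma>\<^sup>2 * \<epsilon> powr (-1) * X = \<alpha> * time_scale \<epsilon> - label_shift \<epsilon>"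
    by (simp add: time_scale_def label_shift_def)
  have x': "\<beta> * \<epsilon> powr (-3/2) * T + \<sigma>\<^sup>2 / \<rho> * \<epsilon> powr (-1) * X + 1 / mesh \<epsilon> * u
      = \<beta> * time_scale \<epsilon> + label_shift \<epsilon> / \<rho> + u / mesh \<epsilon>"
    by (simp add: time_scale_def label_shift_def)
  have y': "1 / mesh \<epsilon> * \<zeta> = \<zeta> / mesh \<epsilon>" by simp
  have "kernel_S_eps p \<rho> a b r T X \<epsilon> \<zeta> u =
      of_real (1 / mesh \<epsilon> / (1 + \<theta>) ^ steps \<epsilon>) * kernel_S p \<rho> a b r (steps \<epsilon>) (label \<epsilon>) y x"
    unfolding kernel_S_eps_def Let_def scale n x' y' x_def y_def steps_def label_def time_scale_def[symmetric] ..
  also have "\<dots> = of_real (1 / mesh \<epsilon>) * (of_real (1 / (1 + \<theta>) ^ steps \<epsilon>) * kernel_S p \<rho> a b r (steps \<epsilon>) (label \<epsilon>) y x)"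
    by simp
  also have "of_real (1 / (1 + \<theta>) ^ steps \<epsilon>) * kernel_S p \<rho> a b r (steps \<epsilon>) (label \<epsilon>) y x =
      1 / (2 * of_real pi * \<i>) * contour_integral (circlepath 0 R) J"
    unfolding J_def surplus_def by (rule kernel_S_eq_circle_integral[OF r R count])
  also have "\<dots> = of_real (mesh \<epsilon>) / (2 * of_real pi) *
     (\<integral>\<tau>. indicator {- (pi / mesh \<epsilon>)..pi / mesh \<epsilon>} \<tau> *\<^sub>R
      (J (of_real R * cis (- (mesh \<epsilon> * \<tau>))) * (of_real R * cis (- (mesh \<epsilon> * \<tau>)))) \<partial>lborel)"
  proof (rule circle_integral_scaled[OF _ R mesh])
    show "continuous_on (sphere 0 R) J"
      unfolding J_def jump_integrand_def using R nonzero_of_real theta_pos by (intro continuous_intros) auto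
  qed
  also have "(\<lambda>\<tau>. J (of_real R * cis (- (mesh \<epsilon> * \<tau>))) * (of_real R * cis (- (mesh \<epsilon> * \<tau>)))) =
      (\<lambda>\<tau>. profile \<epsilon> (Complex c \<tau>) * exp (of_real (u - \<zeta> + rounding \<epsilon> \<zeta> u * mesh \<epsilon>) * Complex c \<tau>))"
    unfolding J_def x_def y_def R_def displacement_def[symmetric]
    by (intro ext jump_integrand_eq_profile mesh)
  finally show ?thesis using mesh by simp
qed

lemma kernel_convergence:
  assumes r: "0 < r" "r < 1"
  shows "uniform_limit {(\<zeta>, u). \<bar>\<zeta> - u\<bar> \<le> M}
           (\<lambda>\<epsilon> (\<zeta>, u). kernel_S_eps p \<rho> a b r T X \<epsilon> \<zeta> u)
           (\<lambda>(\<zeta>, u). limit_S_minus T X \<zeta> u)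
           (at_right 0)"
proof -
  \<comment> \<open>Any \<open>c > 0\<close> with \<open>T c + X > 0\<close> would do.\<close>
  define c where "c = (1 + \<bar>X\<bar>) / T"
  have c: "0 < c" using T_pos by (simp add: c_def)
  have cX: "0 < T * c + X" using T_pos by (simp add: c_def)
  define A where "A = (\<lambda>\<tau>. exp (of_real T * Complex c \<tau> ^ 3 / 3 + of_real X * Complex c \<tau> ^ 2))"
  define B where "B = (\<lambda>\<epsilon> \<tau>. indicator {- (pi / mesh \<epsilon>)..pi / mesh \<epsilon>} \<tau> *\<^sub>R profile \<epsilon> (Complex c \<tau>))"
  have pos: "\<forall>\<^sub>F \<epsilon>::real in at_right 0. 0 < \<epsilon>" by (rule eventually_at_right_less)
  have supp: "indicator {- (pi / mesh \<epsilon>)..pi / mesh \<epsilon>} \<tau> = (if \<bar>mesh \<epsilon> * \<tau>\<bar> \<le> pi then 1 else 0 :: real)"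
    if "0 < \<epsilon>" for \<epsilon> \<tau>
    using mesh_pos[OF that] by (auto simp: indicator_def abs_le_iff field_simps)
  obtain C k where k: "k > 0" and Ck:
    "\<forall>\<^sub>F \<epsilon> in at_right 0. \<forall>\<tau>. \<bar>mesh \<epsilon> * \<tau>\<bar> \<le> pi \<longrightarrow> norm (profile \<epsilon> (Complex c \<tau>)) \<le> C * exp (- k * \<tau>\<^sup>2)"
    using profile_gaussian_bound[OF c cX] by blast
  have Complex_meas [measurable]: "(\<lambda>\<tau>. Complex c \<tau>) \<in> borel_measurable borel"
    unfolding Complex_eq by measurable
  have "uniform_limit {(\<zeta>, u). \<bar>\<zeta> - u\<bar> \<le> M}
     (\<lambda>\<epsilon> (\<zeta>, u). \<integral>\<tau>. B \<epsilon> \<tau> * exp (of_real (u - \<zeta> + rounding \<epsilon> \<zeta> u * mesh \<epsilon>) * Complex c \<tau>) \<partial>lborel)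
     (\<lambda>(\<zeta>, u). \<integral>\<tau>. A \<tau> * exp (of_real (u - \<zeta>) * Complex c \<tau>) \<partial>lborel) (at_right 0)"
  proof (rule uniform_limit_tilted_integrals[OF _ _ _ k _ mesh_tendsto_0])
    show "B \<epsilon> \<in> borel_measurable borel" for \<epsilon> unfolding B_def profile_def by measurable
    show "A \<in> borel_measurable borel" unfolding A_def by measurable
    show "((\<lambda>\<epsilon>. B \<epsilon> \<tau>) \<longlongrightarrow> A \<tau>) (at_right 0)" for \<tau>
    proof -
      have "((\<lambda>\<epsilon>. \<bar>mesh \<epsilon> * \<tau>\<bar>) \<longlongrightarrow> \<bar>0 * \<tau>\<bar>) (at_right 0)"
        by (intro tendsto_intros mesh_tendsto_0)
      hence "\<forall>\<^sub>F \<epsilon> in at_right 0. \<bar>mesh \<epsilon> * \<tau>\<bar> < pi" by (rule order_tendstoD) simp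
      hence "\<forall>\<^sub>F \<epsilon> in at_right 0. profile \<epsilon> (Complex c \<tau>) = B \<epsilon> \<tau>"
        using pos by eventually_elim (simp add: B_def supp)
      thus ?thesis unfolding A_def by (rule Lim_transform_eventually[OF profile_tendsto])
    qed
    show "\<forall>\<^sub>F \<epsilon> in at_right 0. \<forall>\<tau>. norm (B \<epsilon> \<tau>) \<le> C * exp (- k * \<tau>\<^sup>2)"
      using Ck pos
    proof eventually_elim
      case (elim \<epsilon>)
      have "0 \<le> C * exp (- k * 0\<^sup>2)" using order_trans[OF norm_ge_zero elim(1)[rule_format, of 0]] by simp
      hence "0 \<le> C" by simp
      thus ?case using elim(1) by (simp add: B_def supp[OF elim(2)])
    qed
    show "\<forall>\<^sub>F \<epsilon> in at_right 0. 0 < mesh \<epsilon>"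
      using pos by eventually_elim (rule mesh_pos)
    show "\<forall>\<^sub>F \<epsilon> in at_right 0. \<forall>\<tau>. B \<epsilon> \<tau> \<noteq> 0 \<longrightarrow> \<bar>mesh \<epsilon> * \<tau>\<bar> \<le> pi"
      using pos by eventually_elim (simp add: B_def supp)
    show "\<bar>rounding \<epsilon> \<zeta> u\<bar> \<le> 1" for \<epsilon> \<zeta> u by (rule rounding_le_1)
    show "0 < c" by (rule c)
  qed
  hence "uniform_limit {(\<zeta>, u). \<bar>\<zeta> - u\<bar> \<le> M}
     (\<lambda>\<epsilon> z. 1 / (2 * of_real pi) * (case z of (\<zeta>, u) \<Rightarrow> \<integral>\<tau>. B \<epsilon> \<tau> * exp (of_real (u - \<zeta> + rounding \<epsilon> \<zeta> u * mesh \<epsilon>) * Complex c \<tau>) \<partial>lborel))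
     (\<lambda>z. 1 / (2 * of_real pi) * (case z of (\<zeta>, u) \<Rightarrow> \<integral>\<tau>. A \<tau> * exp (of_real (u - \<zeta>) * Complex c \<tau>) \<partial>lborel)) (at_right 0)"
    by (rule bounded_linear.uniform_limit[OF bounded_linear_mult_right])
  also have "?this \<longleftrightarrow> ?thesis"
  proof (rule uniform_limit_cong)
    show "\<forall>\<^sub>F \<epsilon> in at_right 0. \<forall>z\<in>{(\<zeta>, u). \<bar>\<zeta> - u\<bar> \<le> M}.
       1 / (2 * of_real pi) * (case z of (\<zeta>, u) \<Rightarrow> \<integral>\<tau>. B \<epsilon> \<tau> * exp (of_real (u - \<zeta> + rounding \<epsilon> \<zeta> u * mesh \<epsilon>) * Complex c \<tau>) \<partial>lborel)
       = (case z of (\<zeta>, u) \<Rightarrow> kernel_S_eps p \<rho> a b r T X \<epsilon> \<zeta> u)"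
      using pos rounding_errors
      by eventually_elim (auto simp: B_def kernel_S_eps_eq_integral[OF _ _ r, of _ _ _ c])
    fix z :: "real \<times> real"
    show "1 / (2 * of_real pi) * (case z of (\<zeta>, u) \<Rightarrow> \<integral>\<tau>. A \<tau> * exp (of_real (u - \<zeta>) * Complex c \<tau>) \<partial>lborel)
        = (case z of (\<zeta>, u) \<Rightarrow> limit_S_minus T X \<zeta> u)"
      by (auto simp: A_def limit_S_minus_vertical_line[OF T_pos cX] exp_add split: prod.split)
  qed
  finally show ?thesis .
qed

end

theorem proposition5p1:
  fixes p \<rho> r T X M :: real and a b :: nat
  assumes "0 < p" "p < 1"
    and "0 < \<rho>" "\<rho> < 1"
    and "a + b \<ge> 1"
    and "0 < r" "r < 1"
    and "T > 0"
    and "M > 0"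
  shows "uniform_limit {(\<zeta>, u). \<bar>\<zeta> - u\<bar> \<le> M}
           (\<lambda>\<epsilon> (\<zeta>, u). kernel_S_eps p \<rho> a b r T X \<epsilon> \<zeta> u)
           (\<lambda>(\<zeta>, u). limit_S_minus T X \<zeta> u)
           (at_right 0)"
proof -
  interpret scaling p \<rho> a b T X
    using assms by unfold_locales
  show ?thesis by (rule kernel_convergence) fact+
qed

end
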